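(* Let $\{(\mathbb{X}_{\alpha}(t),\mathbb{V}_{\alpha}(t))\}_{t\ge0}$ be the telegraph process with generalized Mittag-Leffler waiting times and velocity driven by random trials (defined in the context). For every $t>0$, the probabilities that the particle is at position $v_1t$ and $-v_2t$ are given by $$\begin{aligned}\mathrm{Pr}\{\mathbb{X}_{\alpha}(t)=v_1t\}={}&\frac{b}{b+r}\Big(1-(\lambda t^\alpha)^{\frac bc+1}E_{\alpha,\alpha(\frac bc+1)+1}^{\frac bc+1}(-\lambda t^\alpha)\Big)\\&+\frac{b(\lambda t^\alpha)^{\frac bc+1}}{(b+r)\Gamma(\frac bc+1)}\,{}_2\Psi_2\!\left[\begin{array}{c}(\frac bc+2,1)\ (\frac{b+r}{c}+1,1)\\(\frac{b+r}{c}+2,1)\ (\alpha(\frac bc+1)+1,\alpha)\end{array}\middle|\,-\lambda t^\alpha\right]\end{aligned}$$ and $$\begin{aligned}\mathrm{Pr}\{\mathbb{X}_{\alpha}(t)=-v_2t\}={}&\frac{r}{b+r}\Big(1-(\mu t^\alpha)^{\frac rc+1}E_{\alpha,\alpha(\frac rc+1)+1}^{\frac rc+1}(-\mu t^\alpha)\Big)\\&+\frac{r(\mu t^\alpha)^{\frac rc+1}}{(b+r)\Gamma(\frac rc+1)}\,{}_2\Psi_2\!\left[\begin{array}{c}(\frac rc+2,1)\ (\frac{b+r}{c}+1,1)\\(\frac{b+r}{c}+2,1)\ (\alpha(\frac rc+1)+1,\alpha)\end{array}\middle|\,-\mu t^\alpha\right],\end{aligned}$$ respectively.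
   Context: Special functions: for $\alpha,\beta,\gamma>0$, $E_{\alpha,\beta}^{\gamma}(x)=\sum_{k\ge0}\frac{(\gamma)_kx^k}{k!\,\Gamma(\alpha k+\beta)}$ with $(\gamma)_k=\Gamma(\gamma+k)/\Gamma(\gamma)$; $E_{\alpha,\beta}=E^1_{\alpha,\beta}$. The generalized (Fox-)Wright function is $${}_p\Psi_q\!\left[\begin{array}{c}(a_1,A_1)\dots(a_p,A_p)\\(b_1,B_1)\dots(b_q,B_q)\end{array}\middle|\,x\right]=\sum_{k=0}^\infty\frac{\prod_{i=1}^p\Gamma(a_i+A_ik)}{\prod_{j=1}^q\Gamma(b_j+B_jk)}\frac{x^k}{k!}.$$ The process: fix $0<\alpha\le1$ and positive constants $v_1,v_2,\lambda,\mu,b,r,c$. Let $\{Y_n\}_{n\ge1}$ be $\{0,1\}$-valued with $\mathrm{Pr}\{Y_1=1\}=\frac{b}{b+r}$ and, for $m\ge1$, $\mathrm{Pr}\{Y_{m+1}=1\mid Y_1,\dots,Y_m\}=\frac{b+c\sum_{i=1}^mY_i}{b+r+cm}$ (Pólya urn scheme). Let $\{R_n\}_{n\ge1}$, $\{L_n\}_{n\ge1}$ be sequences of independent positive random variables with densities, for $t>0$, $f_{R_1}(t)=\lambda^{\frac bc+1}t^{\alpha(\frac bc+1)-1}E_{\alpha,\alpha(\frac bc+1)}^{\frac bc+1}(-\lambda t^\alpha)$, $f_{L_1}(t)=\mu^{\frac rc+1}t^{\alpha(\frac rc+1)-1}E_{\alpha,\alpha(\frac rc+1)}^{\frac rc+1}(-\mu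 t^\alpha)$, and for $n\ge2$, $f_{R_n}(t)=\lambda t^{\alpha-1}E_{\alpha,\alpha}(-\lambda t^\alpha)$, $f_{L_n}(t)=\mu t^{\alpha-1}E_{\alpha,\alpha}(-\mu t^\alpha)$. The sequences $\{Y_n\}$, $\{R_n\}$, $\{L_n\}$ are mutually independent. For $n\ge0$ set $S_n=v_1$ if $Y_{n+1}=1$ and $S_n=-v_2$ if $Y_{n+1}=0$. Set $T_0=0$ and, for $n\ge0$, $T_{n+1}=T_n+R_i$ if $S_n=v_1$ and $Y_1+\dots+Y_n=i-1$, while $T_{n+1}=T_n+L_i$ if $S_n=-v_2$ and $Y_1+\dots+Y_n=n-i+1$. Let $\mathcal{N}(t)=\max\{n\ge0:T_n\le t\}$, $\mathbb{V}_\alpha(t)=S_{\mathcal{N}(t)}$ and $\mathbb{X}_\alpha(t)=\int_0^t\mathbb{V}_\alpha(s)\,\mathrm{d}s$. *)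

theory Defs
  imports "HOL-Probability.Probability"
begin

text \<open>Three-parameter (Prabhakar) Mittag-Leffler function. For \<open>\<gamma> > 0\<close>, \<^term>\<open>pochhammer \<gamma> k\<close> is
  \<open>\<Gamma>(\<gamma> + k) / \<Gamma>(\<gamma>)\<close>, see \<open>pochhammer_Gamma\<close>.\<close>
definition mittag_leffler3 :: "real \<Rightarrow> real \<Rightarrow> real \<Rightarrow> real \<Rightarrow> real" where
  "mittag_leffler3 \<alpha> \<beta> \<gamma> x =
     (\<Sum>k. pochhammer \<gamma> k * x ^ k / (fact k * Gamma (\<alpha> * real k + \<beta>)))"

definition mittag_leffler :: "real \<Rightarrow> real \<Rightarrow> real \<Rightarrow> real" where
  "mittag_leffler \<alpha> \<beta> x = mittag_leffler3 \<alpha> \<beta> 1 x"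

definition fox_wright :: "(real \<times> real) list \<Rightarrow> (real \<times> real) list \<Rightarrow> real \<Rightarrow> real" where
  "fox_wright as bs x =
     (\<Sum>k. (\<Prod>(a, A)\<leftarrow>as. Gamma (a + A * real k)) / (\<Prod>(b, B)\<leftarrow>bs. Gamma (b + B * real k))
          * (x ^ k / fact k))"

text \<open>Nonnegativity is part of being a density; it has to be stated separately because
  \<^const>\<open>ennreal\<close> truncates negative values to \<open>0\<close>.\<close>
definition has_density :: "'a measure \<Rightarrow> ('a \<Rightarrow> real) \<Rightarrow> (real \<Rightarrow> real) \<Rightarrow> bool" where
  "has_density M X f \<longleftrightarrow>
     (AE t in lborel. 0 \<le> f t) \<and> distributed M lborel X (\<lambda>t. ennreal (f t))"

text \<open>The trials \<open>Y\<close> and the waiting times \<open>R\<close>, \<open>L\<close> are indexed from \<open>1\<close>; their values at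
  index \<open>0\<close> are never used.\<close>

definition velocity_after :: "real \<Rightarrow> real \<Rightarrow> (nat \<Rightarrow> 'a \<Rightarrow> nat) \<Rightarrow> nat \<Rightarrow> 'a \<Rightarrow> real" where
  "velocity_after v1 v2 Y n \<omega> = (if Y (Suc n) \<omega> = 1 then v1 else - v2)"

text \<open>The index of the waiting time is the \<open>i\<close> with \<open>Y\<^sub>1 + \<dots> + Y\<^sub>n = i - 1\<close>, respectively
  \<open>Y\<^sub>1 + \<dots> + Y\<^sub>n = n - i + 1\<close>.\<close>
primrec switch_time :: "real \<Rightarrow> real \<Rightarrow> (nat \<Rightarrow> 'a \<Rightarrow> nat) \<Rightarrow> (nat \<Rightarrow> 'a \<Rightarrow> real) \<Rightarrow> (nat \<Rightarrow> 'a \<Rightarrow> real)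
    \<Rightarrow> nat \<Rightarrow> 'a \<Rightarrow> real" where
  "switch_time v1 v2 Y R L 0 \<omega> = 0"
| "switch_time v1 v2 Y R L (Suc n) \<omega> = switch_time v1 v2 Y R L n \<omega> +
     (if velocity_after v1 v2 Y n \<omega> = v1 then R ((\<Sum>j=1..n. Y j \<omega>) + 1) \<omega>
      else L (n + 1 - (\<Sum>j=1..n. Y j \<omega>)) \<omega>)"

text \<open>Under the assumptions below the set is finite almost surely; on the exceptional null set
  \<^const>\<open>Max\<close> is an unspecified constant.\<close>
definition switch_count :: "real \<Rightarrow> real \<Rightarrow> (nat \<Rightarrow> 'a \<Rightarrow> nat) \<Rightarrow> (nat \<Rightarrow> 'a \<Rightarrow> real) \<Rightarrow> (nat \<Rightarrow> 'a \<Rightarrow> real)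
    \<Rightarrow> real \<Rightarrow> 'a \<Rightarrow> nat" where
  "switch_count v1 v2 Y R L t \<omega> = Max {n. switch_time v1 v2 Y R L n \<omega> \<le> t}"

definition telegraph_velocity :: "real \<Rightarrow> real \<Rightarrow> (nat \<Rightarrow> 'a \<Rightarrow> nat) \<Rightarrow> (nat \<Rightarrow> 'a \<Rightarrow> real)
    \<Rightarrow> (nat \<Rightarrow> 'a \<Rightarrow> real) \<Rightarrow> real \<Rightarrow> 'a \<Rightarrow> real" where
  "telegraph_velocity v1 v2 Y R L t \<omega> = velocity_after v1 v2 Y (switch_count v1 v2 Y R L t \<omega>) \<omega>"

definition telegraph_position :: "real \<Rightarrow> real \<Rightarrow> (nat \<Rightarrow> 'a \<Rightarrow> nat) \<Rightarrow> (nat \<Rightarrow> 'a \<Rightarrow> real)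
    \<Rightarrow> (nat \<Rightarrow> 'a \<Rightarrow> real) \<Rightarrow> real \<Rightarrow> 'a \<Rightarrow> real" where
  "telegraph_position v1 v2 Y R L t \<omega> = (LINT s:{0..t}|lborel. telegraph_velocity v1 v2 Y R L s \<omega>)"

locale mittag_leffler_telegraph = prob_space M for M :: "'a measure" +
  fixes \<alpha> v1 v2 lam mu b r c :: real
    and Y :: "nat \<Rightarrow> 'a \<Rightarrow> nat"
    and R L :: "nat \<Rightarrow> 'a \<Rightarrow> real"
  assumes alpha: "0 < \<alpha>" "\<alpha> \<le> 1"
    and pos: "0 < v1" "0 < v2" "0 < lam" "0 < mu" "0 < b" "0 < r" "0 < c"
    and Y_measurable: "\<And>n. n \<ge> 1 \<Longrightarrow> random_variable (count_space UNIV) (Y n)"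
    and Y_values: "\<And>n \<omega>. n \<ge> 1 \<Longrightarrow> \<omega> \<in> space M \<Longrightarrow> Y n \<omega> \<in> {0, 1}"
    and Y_first: "\<P>(\<omega> in M. Y 1 \<omega> = 1) = b / (b + r)"
    and Y_next: "\<And>m y. m \<ge> 1 \<Longrightarrow> \<P>(\<omega> in M. \<forall>i\<in>{1..m}. Y i \<omega> = y i) > 0 \<Longrightarrow>
      \<P>(\<omega> in M. Y (m + 1) \<omega> = 1 \<bar> \<forall>i\<in>{1..m}. Y i \<omega> = y i)
        = (b + c * real (\<Sum>i=1..m. y i)) / (b + r + c * real m)"
    and R_first: "has_density M (R 1) (\<lambda>t. if t > 0 then
        lam powr (b / c + 1) * t powr (\<alpha> * (b / c + 1) - 1)
          * mittag_leffler3 \<alpha> (\<alpha> * (b / c + 1)) (b / c + 1) (- lam * t powr \<alpha>) else 0)"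
    and L_first: "has_density M (L 1) (\<lambda>t. if t > 0 then
        mu powr (r / c + 1) * t powr (\<alpha> * (r / c + 1) - 1)
          * mittag_leffler3 \<alpha> (\<alpha> * (r / c + 1)) (r / c + 1) (- mu * t powr \<alpha>) else 0)"
    and R_next: "\<And>n. n \<ge> 2 \<Longrightarrow> has_density M (R n) (\<lambda>t. if t > 0 then
        lam * t powr (\<alpha> - 1) * mittag_leffler \<alpha> \<alpha> (- lam * t powr \<alpha>) else 0)"
    and L_next: "\<And>n. n \<ge> 2 \<Longrightarrow> has_density M (L n) (\<lambda>t. if t > 0 then
        mu * t powr (\<alpha> - 1) * mittag_leffler \<alpha> \<alpha> (- mu * t powr \<alpha>) else 0)"
    and R_indep: "indep_vars (\<lambda>_. borel) R {1..}"
    and L_indep: "indep_vars (\<lambda>_. borel) L {1..}"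
    \<comment> \<open>the three sequences, as random elements of the space of real sequences, are independent\<close>
    and sequences_indep: "indep_vars (\<lambda>_. PiM {1..} (\<lambda>_. borel))
      (\<lambda>i \<omega>. \<lambda>n\<in>{1..}. [real (Y n \<omega>), R n \<omega>, L n \<omega>] ! i) {..<3}"

end

theory Submission
  imports Defs
begin

text \<open>
  Up to a null set, the particle sits at \<open>v1 t\<close> exactly when no tail occurs among the trials that
  govern the time interval up to \<open>t\<close>. While only heads have occurred, the switching times are
  the partial sums of the waiting times \<open>R\<close>, so the event is the disjoint union over \<open>n\<close> of
  ``the first \<open>n + 1\<close> trials are heads and \<open>t\<close> lies between the \<open>n\<close>-th and the \<open>(n + 1)\<close>-th
  partial sum'' (\<open>telegraph_position_eq_iff\<close>). The urn and the waiting times are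
  independent, hence with \<open>p\<^sub>n\<close> the probability of \<open>n\<close> initial heads and \<open>F\<^sub>n\<close> the distribution
  function of the \<open>n\<close>-th partial sum (\<open>F\<^sub>0 = 1\<close>) the probability is the series of
  \<open>p\<^sub>n\<^sub>+\<^sub>1 (F\<^sub>n(t) - F\<^sub>n\<^sub>+\<^sub>1(t))\<close> (\<open>prob_position_sums\<close>).

  Both ingredients are explicit. Put \<open>a = b/c\<close> and \<open>d = (b + r)/c\<close>. The urn gives
  \<open>p\<^sub>n = (a)\<^sub>n / (d)\<^sub>n\<close>. The Prabhakar densities are series in the kernels
  \<open>t\<^sup>u\<^sup>-\<^sup>1 / \<Gamma>(u)\<close>, which form a convolution semigroup in \<open>u\<close>; so convolving two such series is
  taking the Cauchy product of their coefficients (\<open>kernel_series_convolution\<close>), which for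
  Prabhakar coefficients is the Chu--Vandermonde identity
  (\<open>cauchy_product_prabhakar_coeff\<close>). Therefore the \<open>n\<close>-th partial sum has again a Prabhakar
  density, with parameter \<open>a + n\<close>, and \<open>F\<^sub>n(t)\<close> is a power series.

  Substituting these power series gives an absolutely convergent double series. The term \<open>n = 0\<close>
  is the Mittag-Leffler part of the formula. In the rest, exchanging the order of summation
  leaves, for each power of \<open>t\<close>, a finite alternating sum of reciprocal Pochhammer symbols, which
  collapses to a single fraction (\<open>sum_alternating_inverse_pochhammer\<close>) and yields the
  coefficients of the Wright function (\<open>run_mixture_sums\<close>).

  The second formula is the first one for the process in which heads and tails change
  roles (\<open>heads_tails_swap\<close>).
\<close>

section \<open>A convolution semigroup of power functions\<close>

text \<open>Cut the integral representation of \<open>\<Gamma>(x + 1)\<close> off below \<open>T\<close>. Since \<open>T\<close> is arbitrary, this shows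
  that \<open>1 / \<Gamma>\<close> decays faster than every geometric sequence, which is all that the convergence
  of the series below requires.\<close>
lemma powr_le_Gamma:
  fixes x T :: real
  assumes "x \<ge> 0" "T > 0"
  shows "T powr x * exp (- T) \<le> Gamma (x + 1)"
proof -
  have 1: "((\<lambda>t. T powr x * exp (- t)) has_integral (T powr x * exp (- T))) {T..}"
    using has_integral_exp_minus_to_infinity[of 1 T] by (intro has_integral_mult_right) simp
  have 2: "((\<lambda>t. if t \<in> {T..} then T powr x * exp (- t) else 0) has_integral (T powr x * exp (- T))) {0..}"
    using 1 assms by (subst has_integral_restrict) auto
  have 3: "((\<lambda>t. t powr x / exp t) has_integral Gamma (x + 1)) {0..}"
    using Gamma_integral_real[of "x + 1"] assms by simp
  show ?thesis
  proof (rule has_integral_le[OF 2 3])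
    fix t :: real assume "t \<in> {0..}"
    show "(if t \<in> {T..} then T powr x * exp (- t) else 0) \<le> t powr x / exp t"
      using assms by (auto simp: exp_minus field_simps intro!: powr_mono2)
  qed
qed

text \<open>The kernel of the Riemann--Liouville fractional integral of order \<open>u\<close>.\<close>
definition frac_kernel :: "real \<Rightarrow> real \<Rightarrow> real" where
  "frac_kernel u t = (if t > 0 then t powr (u - 1) / Gamma u else 0)"

text \<open>Mittag-Leffler type functions of \<open>t\<^sup>\<alpha>\<close> are written in this basis because convolution acts on it by
  adding the orders, and integration from \<open>0\<close> by raising \<open>u\<close> by \<open>1\<close>.\<close>
definition kernel_series :: "real \<Rightarrow> (nat \<Rightarrow> real) \<Rightarrow> real \<Rightarrow> real \<Rightarrow> real" where
  "kernel_series \<alpha> a u t = (\<Sum>k. a k * frac_kernel (u + \<alpha> * real k) t)"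

definition geom_bounded :: "(nat \<Rightarrow> real) \<Rightarrow> bool" where
  "geom_bounded a \<longleftrightarrow> (\<exists>C K. \<forall>k. \<bar>a k\<bar> \<le> C * K ^ k)"

definition cauchy_product :: "(nat \<Rightarrow> real) \<Rightarrow> (nat \<Rightarrow> real) \<Rightarrow> nat \<Rightarrow> real" where
  "cauchy_product a b k = (\<Sum>i\<le>k. a i * b (k - i))"

lemma frac_kernel_nonneg: "u > 0 \<Longrightarrow> frac_kernel u t \<ge> 0"
  by (simp add: frac_kernel_def Gamma_real_nonneg)

lemma frac_kernel_measurable [measurable]: "frac_kernel u \<in> borel_measurable borel"
  unfolding frac_kernel_def by measurable

lemma kernel_series_measurable [measurable]: "kernel_series \<alpha> a u \<in> borel_measurable borel"
  unfolding kernel_series_def by measurable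

lemma kernel_series_nonpos: "t \<le> 0 \<Longrightarrow> kernel_series \<alpha> a u t = 0"
  by (simp add: kernel_series_def frac_kernel_def)

lemma geom_boundedE:
  assumes "geom_bounded a"
  obtains C K where "C \<ge> 0" "K \<ge> 1" "\<And>k. \<bar>a k\<bar> \<le> C * K ^ k"
proof -
  obtain C K where CK: "\<And>k. \<bar>a k\<bar> \<le> C * K ^ k"
    using assms by (auto simp: geom_bounded_def)
  show ?thesis
  proof (rule that[of "\<bar>C\<bar>" "max 1 \<bar>K\<bar>"])
    fix k
    have "\<bar>a k\<bar> \<le> \<bar>C * K ^ k\<bar>" using CK[of k] by linarith
    also have "\<dots> = \<bar>C\<bar> * \<bar>K\<bar> ^ k" by (simp add: abs_mult power_abs)
    also have "\<dots> \<le> \<bar>C\<bar> * max 1 \<bar>K\<bar> ^ k" by (intro mult_left_mono power_mono) auto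
    finally show "\<bar>a k\<bar> \<le> \<bar>C\<bar> * max 1 \<bar>K\<bar> ^ k" .
  qed auto
qed

lemma geom_bounded_abs: "geom_bounded a \<Longrightarrow> geom_bounded (\<lambda>k. \<bar>a k\<bar>)"
  by (simp add: geom_bounded_def)

lemma Suc_le_two_power: "real (Suc k) \<le> 2 ^ k"
proof -
  have "Suc k \<le> 2 ^ k" by (simp add: Suc_leI)
  then have "real (Suc k) \<le> real (2 ^ k)" by (simp only: of_nat_le_iff)
  then show ?thesis by simp
qed

lemma geom_bounded_cauchy_product:
  assumes "geom_bounded a" "geom_bounded b"
  shows "geom_bounded (cauchy_product a b)"
proof -
  obtain C K where a: "C \<ge> 0" "K \<ge> 1" "\<And>k. \<bar>a k\<bar> \<le> C * K ^ k" using assms(1) by (rule geom_boundedE) blast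
  obtain D L where b: "D \<ge> 0" "L \<ge> 1" "\<And>k. \<bar>b k\<bar> \<le> D * L ^ k" using assms(2) by (rule geom_boundedE) blast
  define N where "N = max K L"
  have "\<bar>cauchy_product a b k\<bar> \<le> (C * D) * (2 * N) ^ k" for k
  proof -
    have "\<bar>cauchy_product a b k\<bar> \<le> (\<Sum>i\<le>k. \<bar>a i\<bar> * \<bar>b (k - i)\<bar>)"
      unfolding cauchy_product_def by (rule order_trans[OF sum_abs]) (simp add: abs_mult)
    also have "\<dots> \<le> (\<Sum>i\<le>k. (C * D) * N ^ k)"
    proof (rule sum_mono)
      fix i assume i: "i \<in> {..k}"
      have "\<bar>a i\<bar> \<le> C * N ^ i"
        by (rule order_trans[OF a(3)]) (use a in \<open>auto simp: N_def intro!: mult_left_mono power_mono\<close>)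
      moreover have "\<bar>b (k - i)\<bar> \<le> D * N ^ (k - i)"
        by (rule order_trans[OF b(3)]) (use b in \<open>auto simp: N_def intro!: mult_left_mono power_mono\<close>)
      ultimately have "\<bar>a i\<bar> * \<bar>b (k - i)\<bar> \<le> (C * N ^ i) * (D * N ^ (k - i))"
        using a b by (intro mult_mono) (auto simp: N_def)
      also have "\<dots> = (C * D) * N ^ (i + (k - i))" by (simp add: power_add)
      also have "i + (k - i) = k" using i by simp
      finally show "\<bar>a i\<bar> * \<bar>b (k - i)\<bar> \<le> (C * D) * N ^ k" .
    qed
    also have "\<dots> = real (Suc k) * ((C * D) * N ^ k)" by simp
    also have "\<dots> \<le> 2 ^ k * ((C * D) * N ^ k)"
      using a b by (intro mult_right_mono Suc_le_two_power) (auto simp: N_def)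
    finally show ?thesis by (simp add: power_mult_distrib mult_ac)
  qed
  then show ?thesis unfolding geom_bounded_def by blast
qed

lemma kernel_series_abs_summable:
  assumes "\<alpha> > 0" "u > 0" "geom_bounded a"
  shows "summable (\<lambda>k. \<bar>a k * frac_kernel (u + \<alpha> * real k) t\<bar>)"
proof (cases "t > 0")
  case False
  then show ?thesis by (simp add: frac_kernel_def)
next
  case t: True
  obtain C K where a: "C \<ge> 0" "K \<ge> 1" "\<And>k. \<bar>a k\<bar> \<le> C * K ^ k" using assms(3) by (rule geom_boundedE) blast
  define Q where "Q = 1 / (4 * K)"
  \<comment> \<open>Chosen so that \<open>(t / T)\<^sup>\<alpha> = 1 / (4 K)\<close>: one factor \<open>2\<close> absorbs the linear factor \<open>w\<close> coming
    from \<open>\<Gamma>(w + 1) = w \<Gamma>(w)\<close>, the other one leaves the ratio \<open>1/2\<close>.\<close>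
  define T where "T = t * (4 * K) powr (1 / \<alpha>)"
  have T: "T > 0" using t a by (simp add: T_def)
  have ratio: "(t / T) powr \<alpha> = Q"
    using t a assms by (simp add: T_def Q_def powr_divide powr_powr)
  define B where "B = C * (u + \<alpha>) / t * exp T * (t / T) powr u"
  have "\<bar>a k * frac_kernel (u + \<alpha> * real k) t\<bar> \<le> B * (1/2) ^ k" for k
  proof -
    define w where "w = u + \<alpha> * real k"
    have w: "w > 0" using assms by (simp add: w_def add_pos_nonneg)
    have Gw: "Gamma (w + 1) = w * Gamma w" using w by (intro Gamma_plus1) (auto elim!: nonpos_Ints_cases)
    have Gpos: "Gamma w > 0" using w by (simp add: Gamma_real_pos)
    have "T powr w * exp (- T) \<le> Gamma (w + 1)" using w T by (intro powr_le_Gamma) auto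
    then have inv: "1 / Gamma (w + 1) \<le> exp T / T powr w"
      using T Gw Gpos w by (simp add: field_simps exp_minus)
    have "frac_kernel w t = w / t * (t powr w * (1 / Gamma (w + 1)))"
      using t w Gpos by (simp add: frac_kernel_def Gw powr_diff)
    also have "\<dots> \<le> w / t * (t powr w * (exp T / T powr w))"
      using t w inv by (intro mult_left_mono) auto
    also have "\<dots> = w / t * exp T * (t / T) powr w"
      using t T by (simp add: powr_divide)
    also have "(t / T) powr w = (t / T) powr u * Q ^ k"
    proof -
      have "(t / T) powr (\<alpha> * real k) = ((t / T) powr \<alpha>) powr real k" by (simp only: powr_powr)
      also have "\<dots> = Q ^ k" unfolding ratio using a Q_def by (intro powr_realpow) auto
      finally show ?thesis by (simp only: w_def powr_add)
    qed
    finally have 1: "frac_kernel w t \<le> w / t * exp T * ((t / T) powr u * Q ^ k)" .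
    have "w \<le> (u + \<alpha>) * real (Suc k)" using assms by (simp add: w_def algebra_simps)
    also have "\<dots> \<le> (u + \<alpha>) * 2 ^ k" using assms by (intro mult_left_mono Suc_le_two_power) auto
    finally have w2: "w \<le> (u + \<alpha>) * 2 ^ k" .
    have "frac_kernel w t \<le> ((u + \<alpha>) * 2 ^ k) / t * exp T * ((t / T) powr u * Q ^ k)"
    proof (rule order_trans[OF 1])
      have "0 \<le> (t / T) powr u * Q ^ k" using a by (simp add: Q_def)
      moreover have "w / t * exp T \<le> ((u + \<alpha>) * 2 ^ k) / t * exp T"
        using t w2 by (intro mult_right_mono divide_right_mono) auto
      ultimately show "w / t * exp T * ((t / T) powr u * Q ^ k) \<le> ((u + \<alpha>) * 2 ^ k) / t * exp T * ((t / T) powr u * Q ^ k)"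
        by (rule mult_right_mono[rotated])
    qed
    then have "\<bar>a k\<bar> * frac_kernel w t \<le>
        (C * K ^ k) * (((u + \<alpha>) * 2 ^ k) / t * exp T * ((t / T) powr u * Q ^ k))"
      using a frac_kernel_nonneg[OF w] by (intro mult_mono) auto
    also have "\<dots> = B * (K * 2 * Q) ^ k"
    proof -
      have "(K * 2 * Q) ^ k = K ^ k * 2 ^ k * Q ^ k" by (simp only: power_mult_distrib)
      then show ?thesis unfolding B_def by (simp only: times_divide_eq_left times_divide_eq_right mult_ac)
    qed
    also have "K * 2 * Q = 1 / 2" using a by (simp add: Q_def)
    finally have "\<bar>a k\<bar> * frac_kernel w t \<le> B * (1/2) ^ k" .
    moreover have "\<bar>a k * frac_kernel w t\<bar> = \<bar>a k\<bar> * frac_kernel w t"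
      using frac_kernel_nonneg[OF w] by (simp add: abs_mult)
    ultimately show ?thesis by (simp only: w_def)
  qed
  then have bound: "norm \<bar>a k * frac_kernel (u + \<alpha> * real k) t\<bar> \<le> B * (1/2) ^ k" for k
    by (simp only: real_norm_def abs_idempotent)
  have "summable (\<lambda>k. B * (1/2) ^ k)" by (intro summable_mult summable_geometric) simp
  then show ?thesis by (rule summable_comparison_test'[where N = 0]) (rule bound)
qed

lemma Beta_has_bochner_integral:
  fixes u v :: real
  assumes "u > 0" "v > 0"
  shows "has_bochner_integral lborel
    (\<lambda>s. indicator {0<..<1} s * (s powr (v - 1) * (1 - s) powr (u - 1))) (Beta v u)"
proof (rule has_bochner_integral_nn_integral)
  have "((\<lambda>s. s powr (v - 1) * (1 - s) powr (u - 1)) has_integral Beta v u) {0<..<1}"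
    using has_integral_Beta_real[of v u] assms by (simp add: has_integral_Icc_iff_Ioo)
  then have "((\<lambda>s. indicator {0<..<1} s * (s powr (v - 1) * (1 - s) powr (u - 1))) has_integral Beta v u) UNIV"
    by (subst (asm) has_integral_restrict_UNIV[symmetric])
       (erule has_integral_eq[rotated], auto simp: indicator_def)
  then show "(\<integral>\<^sup>+ s. ennreal (indicator {0<..<1} s * (s powr (v - 1) * (1 - s) powr (u - 1))) \<partial>lborel)
      = ennreal (Beta v u)"
    by (intro nn_integral_has_integral_lborel) auto
  show "0 \<le> Beta v u" using assms by (simp add: Beta_def Gamma_real_nonneg)
qed auto

text \<open>The semigroup law is Euler's Beta integral after scaling \<open>y = x s\<close>.\<close>
lemma frac_kernel_convolution:
  assumes "u > 0" "v > 0"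
  shows "has_bochner_integral lborel (\<lambda>y. frac_kernel u (x - y) * frac_kernel v y) (frac_kernel (u + v) x)"
proof (cases "x > 0")
  case False
  then have "(\<lambda>y. frac_kernel u (x - y) * frac_kernel v y) = (\<lambda>_. 0)"
    by (auto simp: frac_kernel_def)
  moreover have "frac_kernel (u + v) x = 0" using False by (simp add: frac_kernel_def)
  ultimately show ?thesis by (simp only: has_bochner_integral_zero)
next
  case x: True
  define A where "A = x powr (u + v - 2) / (Gamma u * Gamma v)"
  have Gpos: "Gamma u > 0" "Gamma v > 0" "Gamma (u + v) > 0"
    using assms by (auto intro: Gamma_real_pos)
  have "has_bochner_integral lborel
     (\<lambda>s. A * (indicator {0<..<1} s * (s powr (v - 1) * (1 - s) powr (u - 1)))) (A * Beta v u)"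
    using Beta_has_bochner_integral[OF assms] by (rule has_bochner_integral_mult_right)
  also have "(\<lambda>s. A * (indicator {0<..<1} s * (s powr (v - 1) * (1 - s) powr (u - 1))))
      = (\<lambda>s. frac_kernel u (x - (0 + x * s)) * frac_kernel v (0 + x * s))"
  proof
    fix s :: real
    show "A * (indicator {0<..<1} s * (s powr (v - 1) * (1 - s) powr (u - 1)))
      = frac_kernel u (x - (0 + x * s)) * frac_kernel v (0 + x * s)"
    proof (cases "0 < s \<and> s < 1")
      case True
      have "x - (0 + x * s) = x * (1 - s)" by (simp add: algebra_simps)
      then have e: "frac_kernel u (x - (0 + x * s)) = x powr (u - 1) * (1 - s) powr (u - 1) / Gamma u"
        using True x by (simp add: frac_kernel_def powr_mult)
      have p: "x powr (u - 1) * x powr (v - 1) = x powr (u + v - 2)"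
        by (simp add: powr_add[symmetric])
      show ?thesis unfolding e using True x
        by (simp add: frac_kernel_def A_def powr_mult p[symmetric] mult_ac)
    next
      case False
      have "\<not> (x - x * s > 0 \<and> x * s > 0)"
        using False x mult_left_mono[of 1 s x] mult_nonneg_nonpos[of x s] by (cases "s \<le> 0") auto
      then show ?thesis using False by (auto simp: frac_kernel_def)
    qed
  qed
  also have "A * Beta v u = frac_kernel (u + v) x /\<^sub>R \<bar>x\<bar>"
  proof -
    have "x powr (u + v - 2) = x powr (u + v - 1) / x"
      using x powr_diff[of x "u + v - 1" 1] by (simp add: algebra_simps)
    then show ?thesis using x Gpos
      by (simp add: A_def Beta_def frac_kernel_def field_simps)
  qed
  finally show ?thesis
    using lborel_has_bochner_integral_real_affine_iff[of x "\<lambda>y. frac_kernel u (x - y) * frac_kernel v y" "frac_kernel (u + v) x" 0] x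
    by simp
qed

text \<open>For fixed \<open>y\<close> the product of the two series is expanded as a Cauchy product, so only one
  infinite sum has to be exchanged with the integral. The exchange is dominated by the same
  construction with the absolute values of the coefficients.\<close>
lemma kernel_series_convolution:
  assumes "\<alpha> > 0" "u > 0" "v > 0" "geom_bounded a" "geom_bounded b"
  shows "has_bochner_integral lborel (\<lambda>y. kernel_series \<alpha> a u (x - y) * kernel_series \<alpha> b v y)
    (kernel_series \<alpha> (cauchy_product a b) (u + v) x)"
proof -
  define A where "A i y = a i * frac_kernel (u + \<alpha> * real i) (x - y)" for i y
  define B where "B i y = b i * frac_kernel (v + \<alpha> * real i) y" for i y
  define f where "f k y = (\<Sum>i\<le>k. A i y * B (k - i) y)" for k y
  define g where "g k = frac_kernel (u + v + \<alpha> * real k) x" for k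
  have pos: "u + \<alpha> * real i > 0" "v + \<alpha> * real i > 0" "u + v + \<alpha> * real i > 0" for i
    using assms by (auto intro!: add_pos_nonneg)
  have AB: "has_bochner_integral lborel (\<lambda>y. A i y * B (k - i) y) (a i * b (k - i) * g k)" if "i \<le> k" for i k
  proof -
    have "has_bochner_integral lborel (\<lambda>y. (a i * b (k - i)) * (frac_kernel (u + \<alpha> * real i) (x - y)
        * frac_kernel (v + \<alpha> * real (k - i)) y))
        ((a i * b (k - i)) * frac_kernel ((u + \<alpha> * real i) + (v + \<alpha> * real (k - i))) x)"
      by (intro has_bochner_integral_mult_right frac_kernel_convolution pos)
    moreover have "(u + \<alpha> * real i) + (v + \<alpha> * real (k - i)) = u + v + \<alpha> * real k"
      using that by (simp add: of_nat_diff algebra_simps)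
    ultimately show ?thesis by (simp add: A_def B_def g_def mult_ac)
  qed
  have AB_abs: "has_bochner_integral lborel (\<lambda>y. \<bar>A i y * B (k - i) y\<bar>) (\<bar>a i\<bar> * \<bar>b (k - i)\<bar> * g k)" if "i \<le> k" for i k
  proof -
    have "has_bochner_integral lborel (\<lambda>y. \<bar>a i * b (k - i)\<bar> * (frac_kernel (u + \<alpha> * real i) (x - y)
        * frac_kernel (v + \<alpha> * real (k - i)) y))
        (\<bar>a i * b (k - i)\<bar> * frac_kernel ((u + \<alpha> * real i) + (v + \<alpha> * real (k - i))) x)"
      by (intro has_bochner_integral_mult_right frac_kernel_convolution pos)
    moreover have "(u + \<alpha> * real i) + (v + \<alpha> * real (k - i)) = u + v + \<alpha> * real k"
      using that by (simp add: of_nat_diff algebra_simps)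
    moreover have "frac_kernel (u + \<alpha> * real i) z \<ge> 0" "frac_kernel (v + \<alpha> * real (k - i)) z \<ge> 0" for z
      by (auto intro!: frac_kernel_nonneg pos)
    ultimately show ?thesis by (simp add: A_def B_def g_def abs_mult mult_ac)
  qed
  have f: "has_bochner_integral lborel (f k) (cauchy_product a b k * g k)" for k
    unfolding f_def cauchy_product_def sum_distrib_right by (intro has_bochner_integral_sum AB) auto
  have f_abs: "has_bochner_integral lborel (\<lambda>y. \<Sum>i\<le>k. \<bar>A i y * B (k - i) y\<bar>)
      (cauchy_product (\<lambda>k. \<bar>a k\<bar>) (\<lambda>k. \<bar>b k\<bar>) k * g k)" for k
    unfolding cauchy_product_def sum_distrib_right by (intro has_bochner_integral_sum AB_abs) auto
  have sA: "summable (\<lambda>i. norm (A i y))" and sB: "summable (\<lambda>i. norm (B i y))" for y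
    unfolding A_def B_def using assms by (auto intro!: kernel_series_abs_summable)
  have sf: "summable (\<lambda>k. norm (f k y))" for y
  proof (rule summable_comparison_test'[where N = 0])
    show "summable (\<lambda>k. \<Sum>i\<le>k. \<bar>A i y\<bar> * \<bar>B (k - i) y\<bar>)"
      using summable_Cauchy_product[of "\<lambda>i. \<bar>A i y\<bar>" "\<lambda>i. \<bar>B i y\<bar>"] sA[of y] sB[of y] by simp
    show "norm (norm (f k y)) \<le> (\<Sum>i\<le>k. \<bar>A i y\<bar> * \<bar>B (k - i) y\<bar>)" for k
      unfolding f_def by (simp add: abs_mult[symmetric] sum_abs)
  qed
  have sums_int: "summable (\<lambda>k. \<integral>y. norm (f k y) \<partial>lborel)"
  proof (rule summable_comparison_test'[where N = 0])
    show "summable (\<lambda>k. \<bar>cauchy_product (\<lambda>k. \<bar>a k\<bar>) (\<lambda>k. \<bar>b k\<bar>) k * g k\<bar>)"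
      unfolding g_def using assms
      by (intro kernel_series_abs_summable geom_bounded_cauchy_product geom_bounded_abs) auto
    show "norm (\<integral>y. norm (f k y) \<partial>lborel) \<le> \<bar>cauchy_product (\<lambda>k. \<bar>a k\<bar>) (\<lambda>k. \<bar>b k\<bar>) k * g k\<bar>" for k
    proof -
      have "(\<integral>y. norm (f k y) \<partial>lborel) \<le> (\<integral>y. (\<Sum>i\<le>k. \<bar>A i y * B (k - i) y\<bar>) \<partial>lborel)"
        proof (rule integral_mono)
          show "integrable lborel (\<lambda>y. norm (f k y))"
            using f[of k] by (intro integrable_norm) (simp add: has_bochner_integral_iff)
          show "integrable lborel (\<lambda>y. \<Sum>i\<le>k. \<bar>A i y * B (k - i) y\<bar>)"
            using f_abs[of k] by (simp add: has_bochner_integral_iff)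
        qed (simp add: f_def sum_abs)
      also have "\<dots> = cauchy_product (\<lambda>k. \<bar>a k\<bar>) (\<lambda>k. \<bar>b k\<bar>) k * g k"
        using f_abs[of k] by (simp add: has_bochner_integral_iff)
      finally show ?thesis by simp
    qed
  qed
  have eq: "kernel_series \<alpha> a u (x - y) * kernel_series \<alpha> b v y = (\<Sum>k. f k y)" for y
    unfolding kernel_series_def f_def using Cauchy_product[OF sA[of y] sB[of y]]
    by (simp add: A_def B_def)
  have int: "integrable lborel (f k)" for k using f[of k] by (simp add: has_bochner_integral_iff)
  have "integrable lborel (\<lambda>y. \<Sum>k. f k y)"
    by (rule integrable_suminf[OF int _ sums_int]) (rule AE_I2, rule sf)
  moreover have "(\<integral>y. (\<Sum>k. f k y) \<partial>lborel) = (\<Sum>k. integral\<^sup>L lborel (f k))"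
    by (rule integral_suminf[OF int _ sums_int]) (rule AE_I2, rule sf)
  moreover have "integral\<^sup>L lborel (f k) = cauchy_product a b k * g k" for k
    using f[of k] by (simp add: has_bochner_integral_iff)
  ultimately show ?thesis unfolding eq
    by (simp add: has_bochner_integral_iff kernel_series_def g_def)
qed

text \<open>The indicator of the positive half-line is the kernel of order \<open>1\<close>, so integration up to \<open>t\<close>
  is a convolution.\<close>
lemma kernel_series_has_integral:
  assumes "\<alpha> > 0" "u > 0" "geom_bounded a"
  shows "has_bochner_integral lborel (\<lambda>y. kernel_series \<alpha> a u y * indicator {..t} y) (kernel_series \<alpha> a (u + 1) t)"
proof -
  define one :: "nat \<Rightarrow> real" where "one k = of_bool (k = 0)" for k
  have one: "geom_bounded one" unfolding geom_bounded_def
    by (intro exI[of _ 1]) (simp add: one_def)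
  have cp: "cauchy_product a one = a"
  proof
    fix k
    have "cauchy_product a one k = (\<Sum>i\<in>{k}. a i * one (k - i))"
      unfolding cauchy_product_def by (intro sum.mono_neutral_right) (auto simp: one_def)
    then show "cauchy_product a one k = a k" by (simp add: one_def)
  qed
  have ks1: "kernel_series \<alpha> one 1 z = of_bool (z > 0)" for z
  proof -
    have "kernel_series \<alpha> one 1 z = (\<Sum>k\<in>{0}. one k * frac_kernel (1 + \<alpha> * real k) z)"
      unfolding kernel_series_def by (intro suminf_finite) (auto simp: one_def)
    then show ?thesis by (simp add: one_def frac_kernel_def)
  qed
  have "has_bochner_integral lborel (\<lambda>y. kernel_series \<alpha> a u (t - y) * kernel_series \<alpha> one 1 y)
    (kernel_series \<alpha> a (u + 1) t)"
    using kernel_series_convolution[OF assms(1,2) _ assms(3) one, of 1 t] by (simp add: cp)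
  then have "has_bochner_integral lborel (\<lambda>y. kernel_series \<alpha> a u (t + (-1) * y) * of_bool (t - (t + (-1) * y) > 0))
    (kernel_series \<alpha> a (u + 1) t /\<^sub>R \<bar>-1\<bar>)"
    by (simp add: ks1)
  then have "has_bochner_integral lborel (\<lambda>y. kernel_series \<alpha> a u y * of_bool (t - y > 0)) (kernel_series \<alpha> a (u + 1) t)"
    by (subst lborel_has_bochner_integral_real_affine_iff[of "-1" _ _ t]) auto
  moreover have "AE y in lborel. kernel_series \<alpha> a u y * of_bool (t - y > 0) = kernel_series \<alpha> a u y * indicator {..t} y"
  proof -
    have "AE y in lborel. y \<noteq> t" by (rule AE_lborel_singleton)
    then show ?thesis by eventually_elim (auto simp: indicator_def)
  qed
  ultimately show ?thesis
    by (subst (asm) has_bochner_integral_cong_AE) auto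
qed


section \<open>Prabhakar densities\<close>

text \<open>The Taylor coefficients of \<open>(l / (1 + l z))\<^sup>\<rho>\<close>; with \<open>z = s\<^sup>-\<^sup>\<alpha>\<close> this is the Laplace transform
  \<open>(l / (l + s\<^sup>\<alpha>))\<^sup>\<rho>\<close> of the Prabhakar density times \<open>s\<^sup>\<alpha>\<^sup>\<rho>\<close>, which is why the Cauchy product adds
  the parameters \<open>\<rho>\<close>.\<close>
definition prabhakar_coeff :: "real \<Rightarrow> real \<Rightarrow> nat \<Rightarrow> real" where
  "prabhakar_coeff l \<rho> k = l powr \<rho> * (pochhammer \<rho> k / fact k) * (- l) ^ k"

lemma pochhammer_le_pow2:
  fixes x :: real
  assumes "0 < x" "x \<le> real n"
  shows "pochhammer x k / fact k \<le> 2 ^ (n + k)"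
proof -
  have "pochhammer x k \<le> pochhammer (real n) k"
    using assms by (auto simp: pochhammer_prod intro!: prod_mono)
  also have "pochhammer (real n) k / fact k = real ((n + k - 1) choose k)"
  proof -
    have "n > 0" using assms by (cases n) auto
    then have "real ((n + k - 1) choose k) = real (n + k - 1) gchoose k"
      by (simp add: binomial_gbinomial)
    also have "\<dots> = pochhammer (real (n + k - 1) - real k + 1) k / fact k"
      by (rule gbinomial_pochhammer')
    also have "real (n + k - 1) - real k + 1 = real n"
      using \<open>n > 0\<close> by (simp add: of_nat_diff)
    finally show ?thesis by simp
  qed
  finally have "pochhammer x k / fact k \<le> real ((n + k - 1) choose k)"
    by (simp add: divide_right_mono)
  also have "\<dots> \<le> real (2 ^ (n + k - 1))" by (simp only: of_nat_le_iff binomial_le_pow2)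
  also have "\<dots> \<le> 2 ^ (n + k)" by (simp add: power_increasing)
  finally show ?thesis .
qed

lemma geom_bounded_prabhakar_coeff:
  assumes "\<rho> > 0" "l > 0"
  shows "geom_bounded (prabhakar_coeff l \<rho>)"
proof -
  obtain n where n: "\<rho> \<le> real n" using real_arch_simple by blast
  have "\<bar>prabhakar_coeff l \<rho> k\<bar> \<le> (l powr \<rho> * 2 ^ n) * (2 * l) ^ k" for k
  proof -
    have "\<bar>prabhakar_coeff l \<rho> k\<bar> = l powr \<rho> * (pochhammer \<rho> k / fact k) * l ^ k"
      using assms by (simp add: prabhakar_coeff_def abs_mult power_abs pochhammer_pos abs_of_pos)
    also have "\<dots> \<le> l powr \<rho> * 2 ^ (n + k) * l ^ k"
      using assms n by (intro mult_right_mono mult_left_mono pochhammer_le_pow2) auto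
    finally show ?thesis by (simp add: power_add power_mult_distrib mult_ac)
  qed
  then show ?thesis unfolding geom_bounded_def by blast
qed

lemma cauchy_product_prabhakar_coeff:
  assumes "l > 0"
  shows "cauchy_product (prabhakar_coeff l \<rho>) (prabhakar_coeff l \<sigma>) = prabhakar_coeff l (\<rho> + \<sigma>)"
proof
  fix k
  have "cauchy_product (prabhakar_coeff l \<rho>) (prabhakar_coeff l \<sigma>) k =
     (\<Sum>i\<le>k. l powr (\<rho> + \<sigma>) * (- l) ^ k / fact k * (real (k choose i) * pochhammer \<rho> i * pochhammer \<sigma> (k - i)))"
    unfolding cauchy_product_def
  proof (rule sum.cong)
    fix i assume i: "i \<in> {..k}"
    have "(- l) ^ k = (- l) ^ i * (- l) ^ (k - i)" using i by (simp add: power_add[symmetric])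
    moreover have "real (k choose i) / fact k = 1 / (fact i * fact (k - i))"
      using i by (simp add: binomial_fact)
    moreover have "i \<le> k" using i by simp
    ultimately show "prabhakar_coeff l \<rho> i * prabhakar_coeff l \<sigma> (k - i) =
      l powr (\<rho> + \<sigma>) * (- l) ^ k / fact k * (real (k choose i) * pochhammer \<rho> i * pochhammer \<sigma> (k - i))"
      by (simp add: prabhakar_coeff_def powr_add field_simps)
  qed simp
  also have "\<dots> = prabhakar_coeff l (\<rho> + \<sigma>) k"
    unfolding prabhakar_coeff_def pochhammer_binomial_sum by (subst sum_distrib_left[symmetric]) simp
  finally show "cauchy_product (prabhakar_coeff l \<rho>) (prabhakar_coeff l \<sigma>) k = prabhakar_coeff l (\<rho> + \<sigma>) k" .
qed

text \<open>For \<open>\<beta> = \<alpha> \<rho>\<close> this is the Prabhakar density, for \<open>\<beta> = \<alpha> \<rho> + 1\<close> its distribution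
  function.\<close>
lemma kernel_series_prabhakar:
  assumes "\<alpha> > 0" "\<beta> > 0" "\<rho> > 0" "l > 0" "t > 0"
  shows "kernel_series \<alpha> (prabhakar_coeff l \<rho>) \<beta> t
    = l powr \<rho> * t powr (\<beta> - 1) * mittag_leffler3 \<alpha> \<beta> \<rho> (- l * t powr \<alpha>)"
proof -
  define m where "m k = pochhammer \<rho> k * (- l * t powr \<alpha>) ^ k / (fact k * Gamma (\<alpha> * real k + \<beta>))" for k
  have summand: "prabhakar_coeff l \<rho> k * frac_kernel (\<beta> + \<alpha> * real k) t = (l powr \<rho> * t powr (\<beta> - 1)) * m k" for k
  proof -
    have 1: "\<beta> + \<alpha> * real k = \<alpha> * real k + \<beta>" by simp
    have 2: "t powr (\<alpha> * real k + \<beta> - 1) = t powr (\<beta> - 1) * (t powr \<alpha>) ^ k"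
      using assms by (simp add: powr_realpow[symmetric] powr_powr powr_add[symmetric] algebra_simps)
    have 3: "(- l * t powr \<alpha>) ^ k = (- l) ^ k * (t powr \<alpha>) ^ k" by (rule power_mult_distrib)
    show ?thesis
      unfolding prabhakar_coeff_def frac_kernel_def m_def 1 2 3 using assms by simp
  qed
  have "summable (\<lambda>k. prabhakar_coeff l \<rho> k * frac_kernel (\<beta> + \<alpha> * real k) t)"
    by (rule summable_rabs_cancel[OF kernel_series_abs_summable])
       (use assms in \<open>auto intro: geom_bounded_prabhakar_coeff\<close>)
  then have "summable (\<lambda>k. (l powr \<rho> * t powr (\<beta> - 1)) * m k)" by (simp add: summand)
  then have "summable m" using assms by (subst (asm) summable_cmult_iff) auto
  then show ?thesis
    unfolding kernel_series_def summand mittag_leffler3_def m_def by (intro suminf_mult) simp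
qed

section \<open>The mixture of arrival probabilities over the length of the run\<close>

text \<open>Fubini for a double series whose columns are finite, so that absolute convergence only has to be
  checked for the sums over the columns.\<close>
lemma sums_triangle:
  fixes H :: "nat \<Rightarrow> nat \<Rightarrow> real"
  assumes zero: "\<And>j k. k < j \<Longrightarrow> H j k = 0"
    and col: "summable (\<lambda>k. \<Sum>j\<le>k. \<bar>H j k\<bar>)"
    and row: "\<And>j. (\<lambda>k. H j k) sums R j"
  shows "R sums (\<Sum>k. \<Sum>j\<le>k. H j k)"
proof -
  define G where "G = (\<lambda>(k, j). H j k)"
  have "(\<lambda>x. norm (G x)) summable_on (SIGMA k:UNIV. {..k})"
    unfolding Infinite_Sum.abs_summable_on_Sigma_iff
  proof (intro conjI ballI)
    show "(\<lambda>j. norm (G (k, j))) summable_on {..k}" for k by (intro summable_on_finite) auto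
    have "(\<lambda>k. \<Sum>j\<le>k. \<bar>H j k\<bar>) summable_on UNIV"
      using col by (subst summable_on_UNIV_nonneg_real_iff) (auto intro: sum_nonneg)
    then show "(\<lambda>k. norm (\<Sum>\<^sub>\<infinity>j\<in>{..k}. norm (G (k, j)))) summable_on UNIV"
      by (simp add: G_def sum_nonneg)
  qed
  then have sG: "G summable_on (SIGMA k:UNIV. {..k})" by (rule abs_summable_summable)
  then obtain S where S: "(G has_sum S) (SIGMA k:UNIV. {..k})" unfolding summable_on_def by blast
  have "((\<lambda>k. \<Sum>j\<le>k. H j k) has_sum S) UNIV"
    using S by (rule has_sum_SigmaD) (auto simp: G_def intro!: has_sum_finite)
  then have 1: "(\<lambda>k. \<Sum>j\<le>k. H j k) sums S" by (rule has_sum_imp_sums)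
  have "(G has_sum S) (UNIV \<times> UNIV)"
    using S by (rule has_sum_cong_neutral[THEN iffD1, rotated -1]) (auto simp: G_def intro!: zero)
  then have 2: "((\<lambda>(j, k). H j k) has_sum S) (UNIV \<times> UNIV)"
    by (subst has_sum_swap) (simp add: G_def)
  have "((\<lambda>k. H j k) has_sum R j) UNIV" for j
  proof -
    have "(\<lambda>k. H j k) summable_on UNIV"
      using 2 by (intro summable_on_SigmaD1[of H UNIV "\<lambda>_. UNIV"]) (auto simp: summable_on_def)
    then obtain s where s: "((\<lambda>k. H j k) has_sum s) UNIV" by (auto simp: summable_on_def)
    then have "(\<lambda>k. H j k) sums s" by (rule has_sum_imp_sums)
    then have "s = R j" using row sums_unique2 by blast
    then show ?thesis using s by simp
  qed
  note rows = this
  have "(R has_sum S) UNIV"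
    by (rule has_sum_SigmaD[OF 2]) (simp only: prod.case rows)
  then have "R sums S" by (rule has_sum_imp_sums)
  then show ?thesis using 1 by (simp add: sums_iff)
qed

text \<open>After multiplication by \<open>fact k\<close> the left-hand side is the \<open>k\<close>-th finite difference of
  \<open>j! / (x)\<^sub>j\<^sub>+\<^sub>1\<close>, the Beta integral of \<open>y\<^sup>x\<^sup>-\<^sup>1 (1 - y)\<^sup>j\<close>; differencing turns \<open>(1 - y)\<^sup>j\<close> into
  \<open>(- y)\<^sup>k\<close>. The induction uses the discrete form of this: multiplying the sum by \<open>k + 1\<close> and
  splitting \<open>k + 1 = (k + 1 - j) + j\<close> reduces it to minus the sum for \<open>k\<close> at \<open>x + 1\<close>.\<close>
lemma sum_alternating_inverse_pochhammer:
  fixes x :: real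
  assumes "x > 0"
  shows "(\<Sum>j\<le>k. (- 1) ^ (k - j) / (fact (k - j) * pochhammer x (Suc j))) = (- 1) ^ k / (fact k * (x + real k))"
  using assms
proof (induction k arbitrary: x)
  case 0
  then show ?case by simp
next
  case (Suc k)
  define S where "S y = (\<Sum>j\<le>k. (- 1) ^ (k - j) / (fact (k - j) * pochhammer y (Suc j)))" for y :: real
  define g where "g j = (- 1) ^ (Suc k - j) / (fact (Suc k - j) * pochhammer x (Suc j))" for j
  have "real (Suc k) * (\<Sum>j\<le>Suc k. g j) = (\<Sum>j\<le>Suc k. real (Suc k - j) * g j) + (\<Sum>j\<le>Suc k. real j * g j)"
    unfolding sum_distrib_left sum.distrib[symmetric] distrib_right[symmetric]
    by (intro sum.cong) (auto simp: of_nat_diff)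
  also have "(\<Sum>j\<le>Suc k. real (Suc k - j) * g j) = (\<Sum>j\<le>k. real (Suc k - j) * g j)" by simp
  also have "\<dots> = - S x"
    unfolding S_def sum_negf[symmetric]
  proof (rule sum.cong)
    fix j assume "j \<in> {..k}"
    then have e: "Suc k - j = Suc (k - j)" by auto
    have f: "fact (Suc (k - j)) = real (Suc (k - j)) * fact (k - j)" by simp
    show "real (Suc k - j) * g j = - ((- 1) ^ (k - j) / (fact (k - j) * pochhammer x (Suc j)))"
      unfolding g_def e f by (simp del: of_nat_Suc fact_Suc)
  qed simp
  also have "(\<Sum>j\<le>Suc k. real j * g j) = (\<Sum>j\<le>k. real (Suc j) * g (Suc j))"
    by (simp add: sum.atMost_Suc_shift del: sum.atMost_Suc of_nat_Suc)
  also have "\<dots> = S x - S (x + 1)"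
    unfolding S_def sum_subtractf[symmetric]
  proof (rule sum.cong)
    fix j assume "j \<in> {..k}"
    define P where "P = pochhammer x (Suc j)"
    define Q where "Q = pochhammer (x + 1) (Suc j)"
    have pos: "P > 0" "Q > 0" using Suc.prems by (auto simp: P_def Q_def intro!: pochhammer_pos)
    have P: "pochhammer x (Suc (Suc j)) = P * (x + real (Suc j))"
      unfolding P_def by (subst pochhammer_Suc) simp
    have Q: "pochhammer x (Suc (Suc j)) = x * Q"
      unfolding Q_def by (rule pochhammer_rec)
    have "real (Suc j) / pochhammer x (Suc (Suc j)) = (x + real (Suc j)) / (P * (x + real (Suc j))) - x / (x * Q)"
      unfolding P[symmetric] Q[symmetric] by (simp add: diff_divide_distrib[symmetric])
    also have "\<dots> = 1 / P - 1 / Q" using Suc.prems by simp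
    finally have *: "real (Suc j) / pochhammer x (Suc (Suc j)) = 1 / P - 1 / Q" .
    have "real (Suc j) * g (Suc j) = (- 1) ^ (k - j) / fact (k - j) * (real (Suc j) / pochhammer x (Suc (Suc j)))"
      by (simp add: g_def del: of_nat_Suc)
    also have "\<dots> = (- 1) ^ (k - j) / (fact (k - j) * P) - (- 1) ^ (k - j) / (fact (k - j) * Q)"
      unfolding * by (simp add: right_diff_distrib)
    finally show "real (Suc j) * g (Suc j) = (- 1) ^ (k - j) / (fact (k - j) * pochhammer x (Suc j))
        - (- 1) ^ (k - j) / (fact (k - j) * pochhammer (x + 1) (Suc j))"
      by (simp only: P_def Q_def)
  qed simp
  finally have "real (Suc k) * (\<Sum>j\<le>Suc k. g j) = - S (x + 1)" by simp
  also have "S (x + 1) = (- 1) ^ k / (fact k * (x + 1 + real k))"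
    unfolding S_def using Suc.prems by (intro Suc.IH) auto
  finally have *: "real (Suc k) * (\<Sum>j\<le>Suc k. g j) = - ((- 1) ^ k / (fact k * (x + 1 + real k)))" .
  have "(\<Sum>j\<le>Suc k. g j) = real (Suc k) * (\<Sum>j\<le>Suc k. g j) / real (Suc k)"
    by (simp del: of_nat_Suc sum.atMost_Suc)
  also have "\<dots> = - ((- 1) ^ k / (fact k * (x + 1 + real k))) / real (Suc k)" by (simp only: *)
  also have "\<dots> = (- 1) ^ Suc k / (fact (Suc k) * (x + real (Suc k)))"
    by (simp add: algebra_simps)
  finally show ?case by (simp add: g_def)
qed

context
  fixes \<alpha> l t a d :: real
begin

text \<open>Here \<open>a = b/c\<close> and \<open>d = (b + r)/c\<close> for the urn. \<open>arrival_cdf n\<close> is the distribution function of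
  the \<open>n\<close>-th partial sum of the waiting times, \<open>run_prob n\<close> the probability that the first \<open>n\<close>
  trials are heads, \<open>arrival_term m\<close> is \<open>(l t\<^sup>\<alpha>)\<^sup>a\<^sup>+\<^sup>m / \<Gamma>(\<alpha> (a + m) + 1)\<close>, and \<open>run_column k\<close> is what
  remains of all contributions with \<open>m = k + 1\<close> after summation over \<open>n \<ge> 1\<close>. The index \<open>n\<close> only
  shifts the index of \<open>arrival_term\<close>, which is what makes the double series triangular.\<close>
definition "arrival_term m = l powr a * l ^ m * frac_kernel (\<alpha> * a + 1 + \<alpha> * real m) t"
definition "arrival_cdf n = kernel_series \<alpha> (prabhakar_coeff l (a + real n)) (\<alpha> * (a + real n) + 1) t"
definition "run_prob n = pochhammer a n / pochhammer d n"

definition "run_column k = a / d * ((- 1) ^ k * pochhammer (a + 1) (Suc k) / (fact k * (d + 1 + real k))) * arrival_term (Suc k)"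

context
  assumes par: "\<alpha> > 0" "l > 0" "t > 0" "a > 0" "d \<ge> a"
begin

lemma arrival_term_nonneg: "arrival_term m \<ge> 0"
proof -
  have "\<alpha> * a + 1 + \<alpha> * real m > 0" using par by (simp add: add_pos_nonneg)
  then show ?thesis using par by (simp add: arrival_term_def frac_kernel_nonneg)
qed

lemma summable_arrival_term: "summable (\<lambda>m. K ^ m * arrival_term m)"
proof -
  have "geom_bounded (\<lambda>m. (K * l) ^ m)"
    unfolding geom_bounded_def by (intro exI[of _ 1] exI[of _ "\<bar>K * l\<bar>"]) (simp add: power_abs)
  then have "summable (\<lambda>m. (K * l) ^ m * frac_kernel (\<alpha> * a + 1 + \<alpha> * real m) t)"
    using par by (intro summable_rabs_cancel[OF kernel_series_abs_summable]) (auto intro: add_nonneg_pos)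
  then have "summable (\<lambda>m. l powr a * ((K * l) ^ m * frac_kernel (\<alpha> * a + 1 + \<alpha> * real m) t))"
    by (rule summable_mult)
  then show ?thesis by (simp add: arrival_term_def power_mult_distrib mult_ac)
qed

lemma arrival_cdf_sums: "(\<lambda>k. (- 1) ^ k * (pochhammer (a + real n) k / fact k) * arrival_term (n + k)) sums arrival_cdf n"
proof -
  have "prabhakar_coeff l (a + real n) k * frac_kernel (\<alpha> * (a + real n) + 1 + \<alpha> * real k) t
     = (- 1) ^ k * (pochhammer (a + real n) k / fact k) * arrival_term (n + k)" for k
  proof -
    have "\<alpha> * (a + real n) + 1 + \<alpha> * real k = \<alpha> * a + 1 + \<alpha> * real (n + k)" by (simp add: algebra_simps)
    moreover have "l powr (a + real n) = l powr a * l ^ n" using par by (simp add: powr_add powr_realpow)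
    moreover have "(- l) ^ k = (- 1) ^ k * l ^ k" by (rule power_minus)
    ultimately show ?thesis unfolding prabhakar_coeff_def arrival_term_def
      by (simp only: power_add mult_ac)
  qed
  moreover have "summable (\<lambda>k. prabhakar_coeff l (a + real n) k * frac_kernel (\<alpha> * (a + real n) + 1 + \<alpha> * real k) t)"
    using par by (intro summable_rabs_cancel[OF kernel_series_abs_summable] geom_bounded_prabhakar_coeff)
      (auto intro: add_nonneg_pos add_pos_nonneg)
  ultimately show ?thesis
    by (simp add: arrival_cdf_def kernel_series_def sums_iff)
qed

text \<open>Pascal's rule for the coefficients of two neighbouring distribution functions.\<close>
lemma arrival_cdf_diff_sums:
  "(\<lambda>k. (- 1) ^ k * (pochhammer (a + real n + 1) k / fact k) * arrival_term (n + k)) sums (arrival_cdf n - arrival_cdf (Suc n))"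
proof -
  define v where "v k = (case k of 0 \<Rightarrow> 0 | Suc i \<Rightarrow> (- 1) ^ i * (pochhammer (a + real (Suc n)) i / fact i) * arrival_term (Suc n + i))" for k
  have "(\<lambda>k. v (Suc k)) sums arrival_cdf (Suc n)" unfolding v_def using arrival_cdf_sums[of "Suc n"] by simp
  then have "v sums arrival_cdf (Suc n)" by (subst (asm) sums_Suc_iff) (simp add: v_def)
  from sums_diff[OF arrival_cdf_sums[of n] this]
  show ?thesis
  proof (rule sums_cong[THEN iffD1, rotated])
    fix k
    show "(- 1) ^ k * (pochhammer (a + real n) k / fact k) * arrival_term (n + k) - v k
      = (- 1) ^ k * (pochhammer (a + real n + 1) k / fact k) * arrival_term (n + k)"
    proof (cases k)
      case (Suc i)
      define x where "x = a + real n"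
      define P where "P = pochhammer (x + 1) i"
      define A where "A = pochhammer x (Suc i) / fact (Suc i)"
      define B where "B = P / fact i"
      have 1: "pochhammer x (Suc i) = x * P" unfolding P_def by (rule pochhammer_rec)
      have 2: "pochhammer (x + 1) (Suc i) = (x + 1 + real i) * P" unfolding P_def by (rule pochhammer_rec')
      have 3: "fact (Suc i) = real (Suc i) * fact i" by simp
      have "B = real (Suc i) * P / fact (Suc i)" unfolding B_def 3 by (simp del: of_nat_Suc)
      then have AB: "pochhammer (x + 1) (Suc i) / fact (Suc i) = A + B"
        unfolding A_def 1 2 by (simp add: add_divide_distrib[symmetric] algebra_simps del: fact_Suc)
      have v: "v (Suc i) = (- 1) ^ i * B * arrival_term (n + Suc i)"
      proof -
        have "a + real (Suc n) = x + 1" "Suc n + i = n + Suc i" by (simp_all add: x_def)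
        then show ?thesis unfolding v_def nat.case B_def P_def by (simp only:)
      qed
      have alg: "(- 1) ^ Suc i * A * E - (- 1) ^ i * B * E = (- 1) ^ Suc i * (A + B) * E" for E :: real
        by (simp add: algebra_simps)
      show ?thesis
        unfolding Suc v x_def[symmetric] AB A_def[symmetric] by (rule alg)
    qed (simp add: v_def)
  qed
qed

text \<open>The series of \<open>arrival_cdf n\<close> starts at \<open>arrival_term n\<close>, and its coefficients
  are at most \<open>2\<^sup>A\<^sup>+\<^sup>n\<^sup>+\<^sup>k\<close> with \<open>A \<ge> a\<close>; so it is dominated by a tail of one convergent series.\<close>
lemma arrival_cdf_tendsto_0: "arrival_cdf \<longlonglongrightarrow> 0"
proof -
  obtain A where A: "a \<le> real A" using real_arch_simple by blast
  define g where "g m = 2 ^ A * (2 ^ m * arrival_term m)" for m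
  have g: "summable g" unfolding g_def by (intro summable_mult summable_arrival_term)
  have "\<bar>arrival_cdf n\<bar> \<le> (\<Sum>k. g (k + n))" for n
  proof -
    have b: "\<bar>(- 1) ^ k * (pochhammer (a + real n) k / fact k) * arrival_term (n + k)\<bar> \<le> g (k + n)" for k
    proof -
      have "\<bar>(- 1) ^ k * (pochhammer (a + real n) k / fact k) * arrival_term (n + k)\<bar> = (pochhammer (a + real n) k / fact k) * arrival_term (n + k)"
        using par arrival_term_nonneg by (simp add: abs_mult abs_of_pos pochhammer_pos add_pos_nonneg)
      also have "\<dots> \<le> 2 ^ ((A + n) + k) * arrival_term (n + k)"
        using par A arrival_term_nonneg by (intro mult_right_mono pochhammer_le_pow2) auto
      finally show ?thesis by (simp add: g_def power_add mult_ac add.commute)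
    qed
    have s: "summable (\<lambda>k. g (k + n))" using g by (subst summable_iff_shift)
    have "\<bar>arrival_cdf n\<bar> = norm (\<Sum>k. (- 1) ^ k * (pochhammer (a + real n) k / fact k) * arrival_term (n + k))"
      using arrival_cdf_sums[of n] by (simp add: sums_iff)
    also have "\<dots> \<le> (\<Sum>k. g (k + n))"
      using b by (intro norm_suminf_le[OF _ s]) simp
    finally show ?thesis .
  qed
  moreover have "(\<lambda>n. \<Sum>k. g (k + n)) \<longlonglongrightarrow> 0" using g by (rule suminf_exist_split2)
  ultimately show ?thesis by (intro Lim_null_comparison[of arrival_cdf]) (auto intro: always_eventually)
qed

lemma run_prob_bounds: "0 \<le> run_prob n" "run_prob n \<le> 1"
proof -
  have "0 \<le> pochhammer a n" "0 < pochhammer d n" using par by (auto intro: pochhammer_pos less_imp_le)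
  moreover have "pochhammer a n \<le> pochhammer d n"
    using par by (auto simp: pochhammer_prod intro!: prod_mono)
  ultimately show "0 \<le> run_prob n" "run_prob n \<le> 1" by (auto simp: run_prob_def)
qed

text \<open>The run must have at least two heads here; the run of length one is the term \<open>n = 0\<close> of the
  mixture, where the distribution function of the empty sum is \<open>1\<close> instead of a power series.\<close>
lemma run_sums: "summable run_column" "(\<lambda>j. run_prob (j + 2) * (arrival_cdf (j + 1) - arrival_cdf (j + 2))) sums suminf run_column"
proof -
  define H where "H j k = (if j \<le> k then run_prob (j + 2) *
    ((- 1) ^ (k - j) * (pochhammer (a + real (j + 2)) (k - j) / fact (k - j)) * arrival_term (Suc k)) else 0)" for j k
  obtain A where A: "a \<le> real A" using real_arch_simple by blast
  have row: "(\<lambda>k. H j k) sums (run_prob (j + 2) * (arrival_cdf (j + 1) - arrival_cdf (j + 2)))" for j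
  proof -
    have "(\<lambda>k. H j (k + j)) sums (run_prob (j + 2) * (arrival_cdf (j + 1) - arrival_cdf (j + 2)))"
      using sums_mult[OF arrival_cdf_diff_sums[of "Suc j"], of "run_prob (j + 2)"]
      by (simp add: H_def algebra_simps)
    moreover have "\<And>k. k < j \<Longrightarrow> H j k = 0" by (simp add: H_def)
    ultimately show ?thesis using sums_zero_iff_shift[of j "H j"] by simp
  qed
  have bound: "(\<Sum>j\<le>k. \<bar>H j k\<bar>) \<le> 2 ^ (A + 2) * (4 ^ Suc k * arrival_term (Suc k))" for k
  proof -
    have "(\<Sum>j\<le>k. \<bar>H j k\<bar>) \<le> (\<Sum>j\<le>k. 2 ^ (A + 2 + k) * arrival_term (Suc k))"
    proof (rule sum_mono)
      fix j assume j: "j \<in> {..k}"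
      define r where "r = pochhammer (a + real (j + 2)) (k - j) / fact (k - j)"
      have q: "0 \<le> r"
        unfolding r_def using par by (intro divide_nonneg_nonneg less_imp_le[OF pochhammer_pos]) auto
      have q2: "r \<le> 2 ^ ((A + (j + 2)) + (k - j))"
        unfolding r_def using par A by (intro pochhammer_le_pow2) auto
      have "\<bar>H j k\<bar> = run_prob (j + 2) * (r * arrival_term (Suc k))"
        unfolding H_def r_def[symmetric] using j q arrival_term_nonneg[of "Suc k"] run_prob_bounds[of "j + 2"]
        by (simp add: abs_mult)
      also have "\<dots> \<le> 1 * (2 ^ ((A + (j + 2)) + (k - j)) * arrival_term (Suc k))"
        using q q2 arrival_term_nonneg run_prob_bounds[of "j + 2"] by (intro mult_mono mult_right_mono mult_nonneg_nonneg) auto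
      also have "(A + (j + 2)) + (k - j) = A + 2 + k" using j by simp
      finally show "\<bar>H j k\<bar> \<le> 2 ^ (A + 2 + k) * arrival_term (Suc k)" by simp
    qed
    also have "\<dots> = real (Suc k) * (2 ^ (A + 2 + k) * arrival_term (Suc k))" by simp
    also have "\<dots> \<le> 2 ^ Suc k * (2 ^ (A + 2 + Suc k) * arrival_term (Suc k))"
      using arrival_term_nonneg by (intro mult_mono mult_right_mono power_increasing order_trans[OF Suc_le_two_power]) auto
    also have "\<dots> = 2 ^ (A + 2) * ((2 * 2) ^ Suc k * arrival_term (Suc k))"
      by (simp only: power_add power_mult_distrib mult_ac)
    finally show ?thesis by simp
  qed
  have s: "summable (\<lambda>k. \<Sum>j\<le>k. \<bar>H j k\<bar>)"
  proof (rule summable_comparison_test'[where N = 0])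
    have "summable (\<lambda>k. 4 ^ k * arrival_term k)" by (rule summable_arrival_term)
    then have "summable (\<lambda>k. 4 ^ Suc k * arrival_term (Suc k))" by (subst summable_Suc_iff)
    then show "summable (\<lambda>k. 2 ^ (A + 2) * (4 ^ Suc k * arrival_term (Suc k)))" by (rule summable_mult)
  qed (use bound in \<open>simp add: sum_nonneg\<close>)
  have run_column: "(\<Sum>j\<le>k. H j k) = run_column k" for k
  proof -
    have "(\<Sum>j\<le>k. H j k) = (\<Sum>j\<le>k. (a / d * pochhammer (a + 1) (Suc k) * arrival_term (Suc k)) *
        ((- 1) ^ (k - j) / (fact (k - j) * pochhammer (d + 1) (Suc j))))"
    proof (rule sum.cong)
      fix j assume j: "j \<in> {..k}"
      have "pochhammer (a + 1) (Suc k) = pochhammer (a + 1) (Suc j + (k - j))" using j by simp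
      also have "\<dots> = pochhammer (a + 1) (Suc j) * pochhammer (a + 1 + real (Suc j)) (k - j)"
        by (rule pochhammer_product')
      finally have 1: "pochhammer (a + 1) (Suc k) = pochhammer (a + 1) (Suc j) * pochhammer (a + real (j + 2)) (k - j)"
        by (simp add: add_ac)
      \<comment> \<open>One factor \<open>a / d\<close> is split off so that the remaining Pochhammer symbols start at
        \<open>a + 1\<close> and \<open>d + 1\<close>; the numerators then combine to a factor free of \<open>j\<close>.\<close>
      have 2: "run_prob (j + 2) = a / d * (pochhammer (a + 1) (Suc j) / pochhammer (d + 1) (Suc j))"
        unfolding run_prob_def by (simp add: pochhammer_rec[of _ "Suc j"] del: pochhammer_Suc)
      show "H j k = (a / d * pochhammer (a + 1) (Suc k) * arrival_term (Suc k)) *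
        ((- 1) ^ (k - j) / (fact (k - j) * pochhammer (d + 1) (Suc j)))"
        unfolding 1 H_def 2 using j by (simp add: mult_ac del: pochhammer_Suc)
    qed simp
    also have "\<dots> = (a / d * pochhammer (a + 1) (Suc k) * arrival_term (Suc k)) * ((- 1) ^ k / (fact k * (d + 1 + real k)))"
      unfolding sum_distrib_left[symmetric] using par by (subst sum_alternating_inverse_pochhammer) auto
    finally show ?thesis by (simp add: run_column_def)
  qed
  show "(\<lambda>j. run_prob (j + 2) * (arrival_cdf (j + 1) - arrival_cdf (j + 2))) sums suminf run_column"
  proof -
    have z: "\<And>j k. k < j \<Longrightarrow> H j k = 0" by (simp add: H_def)
    show ?thesis using sums_triangle[OF z s row] unfolding run_column .
  qed
  show "summable run_column"
    by (rule summable_comparison_test'[OF s, where N = 0]) (simp add: run_column[symmetric] sum_abs)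
qed

lemma run_column_fox_wright:
  "suminf run_column = a / d * (l * t powr \<alpha>) powr (a + 1) / Gamma (a + 1)
          * fox_wright [(a + 2, 1), (d + 1, 1)]
              [(d + 2, 1), (\<alpha> * (a + 1) + 1, \<alpha>)] (- l * t powr \<alpha>)"
proof -
  define f where "f k = (Gamma (a + 2 + real k) * Gamma (d + 1 + real k)) /
     (Gamma (d + 2 + real k) * Gamma (\<alpha> * (a + 1) + 1 + \<alpha> * real k)) * ((- l * t powr \<alpha>) ^ k / fact k)" for k
  define Q where "Q = a / d * (l * t powr \<alpha>) powr (a + 1) / Gamma (a + 1)"
  have eq: "run_column k = Q * f k" for k
  proof -
    have G1: "Gamma (a + 2 + real k) = Gamma (a + 1) * pochhammer (a + 1) (Suc k)"
    proof -
      have "pochhammer (a + 1) (Suc k) = Gamma (a + 1 + real (Suc k)) / Gamma (a + 1)"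
        using par by (intro pochhammer_Gamma) (auto elim!: nonpos_Ints_cases)
      moreover have "Gamma (a + 1) > 0" using par by (intro Gamma_real_pos) auto
      moreover have "a + 2 + real k = a + 1 + real (Suc k)" by simp
      ultimately show ?thesis by (simp only:) simp
    qed
    have G2: "Gamma (d + 2 + real k) = (d + 1 + real k) * Gamma (d + 1 + real k)"
      using Gamma_plus1[of "d + 1 + real k"] par by (simp add: add_ac) (force elim!: nonpos_Ints_cases)
    have pos: "Gamma (a + 1) > 0" "Gamma (d + 1 + real k) > 0" using par by (auto intro!: Gamma_real_pos)
    have p1: "l powr a * l ^ Suc k = l powr (a + 1) * l ^ k" using par by (simp add: powr_add)
    have p2: "t powr (\<alpha> * a + 1 + \<alpha> * real (Suc k) - 1) = (t powr \<alpha>) powr (a + 1) * (t powr \<alpha>) ^ k"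
      using par by (simp add: powr_realpow[symmetric] powr_powr powr_add[symmetric] algebra_simps)
    have p3: "(- l * t powr \<alpha>) ^ k = (- 1) ^ k * l ^ k * (t powr \<alpha>) ^ k"
      by (simp add: power_mult_distrib[symmetric])
    have p4: "\<alpha> * a + 1 + \<alpha> * real (Suc k) = \<alpha> * (a + 1) + 1 + \<alpha> * real k" by (simp add: algebra_simps)
    have e: "arrival_term (Suc k) = l powr (a + 1) * l ^ k * ((t powr \<alpha>) powr (a + 1) * (t powr \<alpha>) ^ k) / Gamma (\<alpha> * (a + 1) + 1 + \<alpha> * real k)"
      unfolding arrival_term_def p1 frac_kernel_def p2 unfolding p4 using par by simp
    have p5: "(l * t powr \<alpha>) powr (a + 1) = l powr (a + 1) * (t powr \<alpha>) powr (a + 1)"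
      using par by (intro powr_mult) 
    have alg: "a / d * (s * P / (f * dk)) * (L * lk * (A * tk) / X)
        = a / d * (L * A) / G * ((G * P * D) / (dk * D * X) * (s * lk * tk / f))"
      if "G > 0" "D > 0" for s P f dk L lk A tk X G D :: real
      using that by (simp add: mult_ac)
    show ?thesis unfolding run_column_def Q_def f_def e G1 G2 p3 p5 by (rule alg[OF pos])
  qed
  have "Gamma (a + 1) \<noteq> 0" using par by (intro less_imp_neq[THEN not_sym] Gamma_real_pos) auto
  then have "Q \<noteq> 0" unfolding Q_def using par by simp
  moreover have "summable (\<lambda>k. Q * f k)" using run_sums(1) unfolding eq[abs_def] .
  ultimately have "summable f" by (subst (asm) summable_cmult_iff) auto
  then have "suminf run_column = Q * suminf f" unfolding eq[abs_def] by (simp add: suminf_mult)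
  moreover have "suminf f = fox_wright [(a + 2, 1), (d + 1, 1)]
              [(d + 2, 1), (\<alpha> * (a + 1) + 1, \<alpha>)] (- l * t powr \<alpha>)"
    unfolding fox_wright_def f_def by simp
  ultimately show ?thesis by (simp add: Q_def)
qed

lemma run_mixture_sums:
  "(\<lambda>n. run_prob (Suc n) * ((if n = 0 then 1 else arrival_cdf n) - arrival_cdf (Suc n))) sums
     (a / d * (1 - (l * t powr \<alpha>) powr (a + 1)
          * mittag_leffler3 \<alpha> (\<alpha> * (a + 1) + 1) (a + 1) (- l * t powr \<alpha>))
      + a / d * (l * t powr \<alpha>) powr (a + 1) / Gamma (a + 1)
          * fox_wright [(a + 2, 1), (d + 1, 1)]
              [(d + 2, 1), (\<alpha> * (a + 1) + 1, \<alpha>)] (- l * t powr \<alpha>))"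
proof -
  define f where "f n = run_prob (Suc n) * ((if n = 0 then 1 else arrival_cdf n) - arrival_cdf (Suc n))" for n
  have "(\<lambda>n. f (Suc n)) sums suminf run_column" using run_sums(2) by (simp add: f_def)
  then have "f sums (suminf run_column + f 0)" by (rule sums_Suc)
  moreover have "arrival_cdf 1 = (l * t powr \<alpha>) powr (a + 1) * mittag_leffler3 \<alpha> (\<alpha> * (a + 1) + 1) (a + 1) (- l * t powr \<alpha>)"
  proof -
    have "arrival_cdf 1 = l powr (a + 1) * t powr (\<alpha> * (a + 1)) * mittag_leffler3 \<alpha> (\<alpha> * (a + 1) + 1) (a + 1) (- l * t powr \<alpha>)"
      unfolding arrival_cdf_def using par
      by (subst kernel_series_prabhakar) (auto intro: add_pos_pos)
    also have "l powr (a + 1) * t powr (\<alpha> * (a + 1)) = (l * t powr \<alpha>) powr (a + 1)"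
      using par by (simp add: powr_mult powr_powr)
    finally show ?thesis .
  qed
  moreover have "f 0 = a / d * (1 - arrival_cdf 1)" by (simp add: f_def run_prob_def)
  ultimately show ?thesis by (simp only: f_def[abs_def] run_column_fox_wright add.commute)
qed

end

end

section \<open>Random variables with kernel series densities\<close>

text \<open>The series of the sum is nonnegative everywhere, because it is at every point the value of a
  convolution integral of two almost everywhere nonnegative functions.\<close>
lemma (in prob_space) has_density_kernel_series_add:
  assumes par: "\<alpha> > 0" "u > 0" "v > 0" "geom_bounded a" "geom_bounded b"
    and X: "has_density M X (kernel_series \<alpha> a u)"
    and Y: "has_density M Y (kernel_series \<alpha> b v)"
    and ind: "indep_var borel X borel Y"
  shows "has_density M (\<lambda>\<omega>. X \<omega> + Y \<omega>) (kernel_series \<alpha> (cauchy_product a b) (u + v))"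
proof -
  let ?f = "kernel_series \<alpha> a u" and ?g = "kernel_series \<alpha> b v"
  let ?h = "kernel_series \<alpha> (cauchy_product a b) (u + v)"
  have nn: "AE y in lborel. 0 \<le> ?f (x - y) * ?g y" for x
  proof -
    have "AE y in lborel. 0 \<le> ?f (x + (-1) * y)"
      using X by (intro AE_borel_affine) (auto simp: has_density_def)
    moreover have "AE y in lborel. 0 \<le> ?g y" using Y by (simp add: has_density_def)
    ultimately show ?thesis by eventually_elim simp
  qed
  have conv: "has_bochner_integral lborel (\<lambda>y. ?f (x - y) * ?g y) (?h x)" for x
    by (intro kernel_series_convolution par)
  have h_nonneg: "0 \<le> ?h x" for x
    using conv[of x] integral_nonneg_AE[OF nn[of x]] by (simp add: has_bochner_integral_iff)
  have conv_nn: "(\<integral>\<^sup>+ y. ennreal (?f (x - y)) * ennreal (?g y) \<partial>lborel) = ennreal (?h x)" for x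
  proof -
    have "AE y in lborel. 0 \<le> ?g y" using Y by (simp add: has_density_def)
    then have "(\<integral>\<^sup>+ y. ennreal (?f (x - y)) * ennreal (?g y) \<partial>lborel)
      = (\<integral>\<^sup>+ y. ennreal (?f (x - y) * ?g y) \<partial>lborel)"
      by (intro nn_integral_cong_AE, eventually_elim) (simp add: ennreal_mult'')
    also have "\<dots> = ennreal (\<integral>y. ?f (x - y) * ?g y \<partial>lborel)"
      using conv[of x] nn[of x] by (intro nn_integral_eq_integral) (auto simp: has_bochner_integral_iff)
    finally show ?thesis using conv[of x] by (simp add: has_bochner_integral_iff)
  qed
  have "distributed M lborel (\<lambda>\<omega>. X \<omega> + Y \<omega>) (\<lambda>x. \<integral>\<^sup>+ y. ennreal (?f (x - y)) * ennreal (?g y) \<partial>lborel)"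
    using X Y by (intro distributed_convolution ind) (auto simp: has_density_def)
  then show ?thesis unfolding conv_nn has_density_def using h_nonneg by simp
qed

lemma (in prob_space) has_density_kernel_series_cdf:
  assumes par: "\<alpha> > 0" "u > 0" "geom_bounded a"
    and X: "has_density M X (kernel_series \<alpha> a u)"
  shows "\<P>(\<omega> in M. X \<omega> \<le> t) = kernel_series \<alpha> a (u + 1) t"
proof -
  let ?f = "kernel_series \<alpha> a u"
  have int: "has_bochner_integral lborel (\<lambda>y. ?f y * indicator {..t} y) (kernel_series \<alpha> a (u + 1) t)"
    by (intro kernel_series_has_integral par)
  have f: "AE y in lborel. 0 \<le> ?f y" using X by (simp add: has_density_def)
  have nn: "AE y in lborel. 0 \<le> ?f y * indicator {..t} y"
    using f by eventually_elim simp
  have "emeasure M (X -` {..t} \<inter> space M) = (\<integral>\<^sup>+ y. ennreal (?f y) * indicator {..t} y \<partial>lborel)"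
    using X by (intro distributed_emeasure) (auto simp: has_density_def)
  also have "\<dots> = (\<integral>\<^sup>+ y. ennreal (?f y * indicator {..t} y) \<partial>lborel)"
    by (intro nn_integral_cong) (simp add: indicator_def)
  also have "\<dots> = ennreal (\<integral>y. ?f y * indicator {..t} y \<partial>lborel)"
    using int nn by (intro nn_integral_eq_integral) (auto simp: has_bochner_integral_iff)
  finally have "measure M (X -` {..t} \<inter> space M) = (\<integral>y. ?f y * indicator {..t} y \<partial>lborel)"
    using integral_nonneg_AE[OF nn] by (simp add: measure_def)
  also have "\<dots> = kernel_series \<alpha> a (u + 1) t"
    using int by (simp add: has_bochner_integral_iff)
  also have "X -` {..t} \<inter> space M = {\<omega> \<in> space M. X \<omega> \<le> t}" by auto
  finally show ?thesis .
qed

lemma (in prob_space) has_density_AE_neq: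
  assumes "has_density M X f"
  shows "AE \<omega> in M. X \<omega> \<noteq> x"
proof (rule AE_I)
  have "emeasure M (X -` {x} \<inter> space M) = (\<integral>\<^sup>+ y. ennreal (f y) * indicator {x} y \<partial>lborel)"
    using assms by (intro distributed_emeasure) (auto simp: has_density_def)
  also have "\<dots> = 0"
  proof -
    have "AE y in lborel. y \<noteq> x" by (rule AE_lborel_singleton)
    then have "AE y in lborel. ennreal (f y) * indicator {x} y = 0" by eventually_elim simp
    from nn_integral_cong_AE[OF this] show ?thesis by simp
  qed
  finally show "emeasure M (X -` {x} \<inter> space M) = 0" .
  show "X -` {x} \<inter> space M \<in> events"
    using assms by (intro measurable_sets[of X M lborel]) (auto simp: has_density_def distributed_def)
qed auto

lemma has_density_measurable: "has_density M X f \<Longrightarrow> X \<in> borel_measurable M"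
  by (simp add: has_density_def distributed_def)

lemma (in prob_space) AE_not_of_prob_zero:
  assumes "{\<omega> \<in> space M. P \<omega>} \<in> events" "prob {\<omega> \<in> space M. P \<omega>} = 0"
  shows "AE \<omega> in M. \<not> P \<omega>"
proof -
  have "AE \<omega> in M. \<omega> \<notin> {\<omega> \<in> space M. P \<omega>}"
    using assms prob_eq_0 by blast
  then show ?thesis using AE_space by eventually_elim simp
qed

lemma (in prob_space) has_density_kernel_series_AE_pos:
  assumes par: "\<alpha> > 0" "u > 0" "geom_bounded a"
    and X: "has_density M X (kernel_series \<alpha> a u)"
  shows "AE \<omega> in M. X \<omega> > 0"
proof -
  have [measurable]: "X \<in> borel_measurable M" using X by (rule has_density_measurable)
  have "prob {\<omega> \<in> space M. X \<omega> \<le> 0} = 0"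
    using has_density_kernel_series_cdf[OF par X, of 0] by (simp add: kernel_series_nonpos)
  then have "AE \<omega> in M. \<not> X \<omega> \<le> 0" by (intro AE_not_of_prob_zero) auto
  then show ?thesis by eventually_elim simp
qed

section \<open>Partial sums and clocks\<close>

definition partial_sum :: "(nat \<Rightarrow> 'a \<Rightarrow> real) \<Rightarrow> nat \<Rightarrow> 'a \<Rightarrow> real" where
  "partial_sum X n \<omega> = (\<Sum>i=1..n. X i \<omega>)"

lemma partial_sum_0 [simp]: "partial_sum X 0 \<omega> = 0"
  by (simp add: partial_sum_def)

lemma partial_sum_Suc [simp]: "partial_sum X (Suc n) \<omega> = partial_sum X n \<omega> + X (Suc n) \<omega>"
  by (simp add: partial_sum_def)

lemma partial_sum_mono:
  assumes "\<forall>i\<ge>1. X i \<omega> > (0::real)" "m \<le> n"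
  shows "partial_sum X m \<omega> \<le> partial_sum X n \<omega>"
  unfolding partial_sum_def using assms by (intro sum_mono2) (auto intro: less_imp_le)

lemma Max_clock:
  fixes T :: "nat \<Rightarrow> real"
  assumes mono: "strict_mono T" and T0: "T 0 \<le> s" and unbounded: "\<exists>n. T n > s"
  defines "N \<equiv> Max {n. T n \<le> s}"
  shows "T N \<le> s" "s < T (Suc N)" "\<And>n. s < T (Suc n) \<Longrightarrow> N \<le> n" "\<And>n. T n \<le> s \<Longrightarrow> n \<le> N"
proof -
  obtain m where m: "T m > s" using unbounded by blast
  have less: "n < k" if "T n \<le> s" "s < T k" for n k
    using that mono by (meson le_less_trans strict_mono_less)
  have fin: "finite {n. T n \<le> s}" by (rule finite_subset[of _ "{..<m}"]) (use less m in auto)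
  have ne: "{n. T n \<le> s} \<noteq> {}" using T0 by auto
  show N: "T N \<le> s" using Max_in[OF fin ne] by (simp add: N_def)
  show le: "n \<le> N" if "T n \<le> s" for n using Max_ge[OF fin] that by (simp add: N_def)
  show "s < T (Suc N)" using le[of "Suc N"] by linarith
  show "N \<le> n" if "s < T (Suc n)" for n using less[OF N that] by simp
qed

section \<open>The waiting times and the urn\<close>

context mittag_leffler_telegraph
begin

abbreviation "T \<equiv> switch_time v1 v2 Y R L"
abbreviation "V \<equiv> telegraph_velocity v1 v2 Y R L"
abbreviation "N \<equiv> switch_count v1 v2 Y R L"

lemma velocity_after_eq [simp]: "velocity_after v1 v2 Y n \<omega> = v1 \<longleftrightarrow> Y (Suc n) \<omega> = 1"
  using pos by (simp add: velocity_after_def)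

lemma head_count_le: "\<omega> \<in> space M \<Longrightarrow> (\<Sum>j=1..n. Y j \<omega>) \<le> n"
proof (induction n)
  case (Suc n)
  then show ?case using Y_values[of "Suc n" \<omega>] by auto
qed simp

lemma R_density: "n \<ge> 1 \<Longrightarrow> has_density M (R n)
    (kernel_series \<alpha> (prabhakar_coeff lam (if n = 1 then b / c + 1 else 1)) (\<alpha> * (if n = 1 then b / c + 1 else 1)))"
proof -
  assume n: "n \<ge> 1"
  have eq: "kernel_series \<alpha> (prabhakar_coeff lam \<rho>) (\<alpha> * \<rho>) = (\<lambda>t. if t > 0 then
        lam powr \<rho> * t powr (\<alpha> * \<rho> - 1) * mittag_leffler3 \<alpha> (\<alpha> * \<rho>) \<rho> (- lam * t powr \<alpha>) else 0)" if "\<rho> > 0" for \<rho>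
    using that alpha pos by (intro ext) (simp add: kernel_series_prabhakar kernel_series_nonpos)
  show ?thesis
  proof (cases "n = 1")
    case True
    have "b / c + 1 > 0" using pos by (simp add: add_pos_pos)
    then show ?thesis using R_first True by (simp add: eq)
  next
    case False
    have "kernel_series \<alpha> (prabhakar_coeff lam 1) \<alpha> = (\<lambda>t. if t > 0 then
        lam * t powr (\<alpha> - 1) * mittag_leffler \<alpha> \<alpha> (- lam * t powr \<alpha>) else 0)"
      using eq[of 1] pos by (simp add: mittag_leffler_def cong: if_cong)
    then show ?thesis using R_next[of n] n False by simp
  qed
qed

lemma R_measurable [measurable]: "n \<ge> 1 \<Longrightarrow> R n \<in> borel_measurable M"
  by (rule has_density_measurable[OF R_density])

lemma R_AE_pos: "AE \<omega> in M. \<forall>i\<ge>1. R i \<omega> > 0"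
proof -
  have "b / c + 1 > 0" using pos by (simp add: add_pos_pos)
  then have "AE \<omega> in M. R i \<omega> > 0" if "i \<ge> 1" for i
    using alpha pos by (intro has_density_kernel_series_AE_pos[OF _ _ _ R_density[OF that]] geom_bounded_prabhakar_coeff) auto
  then show ?thesis by (subst AE_all_countable) (auto intro: AE_I2)
qed

text \<open>The first waiting time has parameter \<open>b/c + 1\<close>, each later one adds \<open>1\<close>.\<close>
lemma partial_sum_R_density:
  assumes "n \<ge> 1"
  shows "has_density M (partial_sum R n)
    (kernel_series \<alpha> (prabhakar_coeff lam (b / c + real n)) (\<alpha> * (b / c + real n)))"
  using assms
proof (induction n rule: dec_induct)
  case base
  have "partial_sum R 1 = R 1" by (rule ext) (simp add: partial_sum_def)
  then show ?case using R_density[of 1] by simp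
next
  case (step n)
  define \<rho> where "\<rho> = b / c + real n"
  have \<rho>: "\<rho> > 0" using pos step by (simp add: \<rho>_def add_pos_nonneg)
  have "indep_var borel (R (Suc n)) borel (\<lambda>\<omega>. \<Sum>i\<in>{1..n}. R i \<omega>)"
  proof (rule indep_vars_sum)
    show "indep_vars (\<lambda>_. borel) R (insert (Suc n) {1..n})"
      by (rule indep_vars_subset[OF R_indep]) auto
  qed auto
  then have ind: "indep_var borel (R (Suc n)) borel (partial_sum R n)"
    by (simp add: partial_sum_def[abs_def])
  have R: "has_density M (R (Suc n)) (kernel_series \<alpha> (prabhakar_coeff lam 1) \<alpha>)"
    using R_density[of "Suc n"] step by simp
  have "has_density M (\<lambda>\<omega>. R (Suc n) \<omega> + partial_sum R n \<omega>)
     (kernel_series \<alpha> (cauchy_product (prabhakar_coeff lam 1) (prabhakar_coeff lam \<rho>)) (\<alpha> + \<alpha> * \<rho>))"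
    using alpha pos \<rho> step.IH
    by (intro has_density_kernel_series_add ind R geom_bounded_prabhakar_coeff) (auto simp: \<rho>_def)
  moreover have eq: "(\<lambda>\<omega>. R (Suc n) \<omega> + partial_sum R n \<omega>) = partial_sum R (Suc n)"
    by (rule ext) simp
  moreover have "\<alpha> + \<alpha> * \<rho> = \<alpha> * (b / c + real (Suc n))" "1 + \<rho> = b / c + real (Suc n)"
    by (simp_all add: \<rho>_def algebra_simps)
  ultimately show ?case using pos unfolding eq by (simp add: cauchy_product_prabhakar_coeff del: partial_sum_Suc)
qed

lemma partial_sum_R_measurable [measurable]: "partial_sum R n \<in> borel_measurable M"
  unfolding partial_sum_def by (intro borel_measurable_sum) auto

lemma partial_sum_R_cdf:
  assumes "n \<ge> 1"
  shows "\<P>(\<omega> in M. partial_sum R n \<omega> \<le> t) = arrival_cdf \<alpha> lam t (b / c) n"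
proof -
  have "b / c + real n > 0" using pos by (simp add: add_pos_nonneg)
  then show ?thesis
    unfolding arrival_cdf_def using alpha pos
    by (intro has_density_kernel_series_cdf[OF _ _ _ partial_sum_R_density[OF assms]] geom_bounded_prabhakar_coeff) auto
qed

text \<open>The distribution functions of the partial sums tend to \<open>0\<close> at every point, so almost surely no
  level is an upper bound.\<close>
lemma partial_sum_R_AE_unbounded: "AE \<omega> in M. \<forall>x. \<exists>n. partial_sum R n \<omega> > x"
proof -
  have *: "AE \<omega> in M. \<exists>n. partial_sum R n \<omega> > real (Suc m)" for m
  proof -
    define A where "A = {\<omega> \<in> space M. \<forall>n. partial_sum R n \<omega> \<le> real (Suc m)}"
    have A [measurable]: "A \<in> events" unfolding A_def by measurable
    have lim: "arrival_cdf \<alpha> lam (real (Suc m)) (b / c) \<longlonglongrightarrow> 0"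
      by (rule arrival_cdf_tendsto_0[where d = "b / c"]) (use alpha pos in auto)
    have "prob A \<le> arrival_cdf \<alpha> lam (real (Suc m)) (b / c) n" if "n \<ge> 1" for n
      unfolding partial_sum_R_cdf[OF that, symmetric] by (intro finite_measure_mono) (auto simp: A_def)
    then have "prob A \<le> 0" by (intro Lim_bounded2[OF lim]) auto
    then have "prob A = 0" using measure_nonneg[of M A] by linarith
    then have "AE \<omega> in M. \<not> (\<forall>n. partial_sum R n \<omega> \<le> real (Suc m))"
      using A unfolding A_def by (intro AE_not_of_prob_zero)
    then show ?thesis by eventually_elim (auto simp: not_le)
  qed
  have "AE \<omega> in M. \<forall>m. \<exists>n. partial_sum R n \<omega> > real (Suc m)"
    using * by (subst AE_all_countable) auto
  then show ?thesis
  proof eventually_elim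
    case (elim \<omega>)
    show ?case
    proof
      fix x
      obtain m where "x \<le> real m" using real_arch_simple by blast
      moreover obtain n where "partial_sum R n \<omega> > real (Suc m)" using elim by blast
      ultimately show "\<exists>n. partial_sum R n \<omega> > x" by (intro exI[of _ n]) simp
    qed
  qed
qed

lemma partial_sum_R_AE_neq: "t > 0 \<Longrightarrow> AE \<omega> in M. \<forall>n. partial_sum R n \<omega> \<noteq> t"
proof (subst AE_all_countable, intro allI)
  fix n assume "t > 0"
  then show "AE \<omega> in M. partial_sum R n \<omega> \<noteq> t"
    by (cases n) (auto intro!: has_density_AE_neq partial_sum_R_density simp del: partial_sum_Suc)
qed

text \<open>Dividing numerator and denominator of each conditional probability \<open>(b + c i) / (b + r + c i)\<close>
  by \<open>c\<close> turns their product over \<open>i < n\<close> into a quotient of Pochhammer symbols.\<close>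
lemma heads_run_prob: "\<P>(\<omega> in M. \<forall>i\<in>{1..n}. Y i \<omega> = 1) = run_prob (b / c) ((b + r) / c) n"
proof (induction n)
  case 0
  then show ?case by (simp add: prob_space run_prob_def)
next
  case (Suc n)
  define P where "P = \<P>(\<omega> in M. \<forall>i\<in>{1..n}. Y i \<omega> = 1)"
  have d: "b / c > 0" "(b + r) / c > 0" using pos by auto
  have step: "run_prob (b / c) ((b + r) / c) (Suc n)
      = run_prob (b / c) ((b + r) / c) n * ((b + c * real n) / (b + r + c * real n))"
  proof -
    have "b / c + real n = (b + c * real n) / c" "(b + r) / c + real n = (b + r + c * real n) / c"
      using pos by (simp_all add: field_simps)
    then have "(b / c + real n) / ((b + r) / c + real n) = (b + c * real n) / (b + r + c * real n)"
      using pos by (simp only:) simp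
    then show ?thesis by (simp only: run_prob_def pochhammer_Suc times_divide_times_eq[symmetric])
  qed
  show ?case
  proof (cases "n = 0")
    case True
    have "{\<omega> \<in> space M. \<forall>i\<in>{1..Suc n}. Y i \<omega> = 1} = {\<omega> \<in> space M. Y 1 \<omega> = 1}" using True by auto
    then show ?thesis using Y_first True step pos by (simp add: run_prob_def)
  next
    case False
    have "P > 0" using Suc.IH d by (simp add: P_def run_prob_def pochhammer_pos)
    then have "\<P>(\<omega> in M. Y (n + 1) \<omega> = 1 \<bar> \<forall>i\<in>{1..n}. Y i \<omega> = 1) = (b + c * real n) / (b + r + c * real n)"
      using Y_next[of n "\<lambda>_. 1"] False by (simp add: P_def)
    then have "\<P>(\<omega> in M. Y (n + 1) \<omega> = 1 \<and> (\<forall>i\<in>{1..n}. Y i \<omega> = 1)) / P = (b + c * real n) / (b + r + c * real n)"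
      by (simp add: cond_prob_def P_def)
    then have "\<P>(\<omega> in M. Y (n + 1) \<omega> = 1 \<and> (\<forall>i\<in>{1..n}. Y i \<omega> = 1)) = P * ((b + c * real n) / (b + r + c * real n))"
      using \<open>P > 0\<close> by (simp add: field_simps)
    moreover have "(\<forall>i\<in>{1..Suc n}. Y i \<omega> = 1) \<longleftrightarrow> Y (n + 1) \<omega> = 1 \<and> (\<forall>i\<in>{1..n}. Y i \<omega> = 1)" for \<omega>
      by (auto simp: le_Suc_eq)
    ultimately show ?thesis unfolding step Suc.IH[symmetric] P_def by simp
  qed
qed

declare Y_measurable [measurable]

text \<open>Both events are expressed through the random sequences \<open>Y\<close> and \<open>R\<close> in the product space,
  where independence of the sequences is available.\<close>
lemma run_indep_partial_sum:
  "\<P>(\<omega> in M. (\<forall>i\<in>{1..Suc n}. Y i \<omega> = 1) \<and> partial_sum R n \<omega> \<le> t \<and> t < partial_sum R (Suc n) \<omega>)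
    = \<P>(\<omega> in M. \<forall>i\<in>{1..Suc n}. Y i \<omega> = 1) * \<P>(\<omega> in M. partial_sum R n \<omega> \<le> t \<and> t < partial_sum R (Suc n) \<omega>)"
proof -
  define X where "X i \<omega> = (\<lambda>n\<in>{1::nat..}. [real (Y n \<omega>), R n \<omega>, L n \<omega>] ! i)" for i \<omega>
  let ?S = "PiM {1::nat..} (\<lambda>_. borel :: real measure)"
  define A0 where "A0 = {y \<in> space ?S. \<forall>i\<in>{1..Suc n}. y i = 1}"
  define A1 where "A1 = {x \<in> space ?S. (\<Sum>i=1..n. x i) \<le> t \<and> t < (\<Sum>i=1..Suc n. x i)}"
  have comp: "(\<lambda>x. x i) \<in> borel_measurable ?S" if "i \<ge> 1" for i
    using that by (intro measurable_component_singleton) auto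
  have sum: "(\<lambda>x. \<Sum>i=1..k. x i) \<in> borel_measurable ?S" for k
    by (intro borel_measurable_sum comp) auto
  note [measurable] = sum
  have A0: "A0 \<in> sets ?S"
    unfolding A0_def
  proof (rule sets.sets_Collect_finite_All)
    fix i assume "i \<in> {1..Suc n}"
    then have [measurable]: "(\<lambda>x. x i) \<in> borel_measurable ?S" by (intro comp) auto
    show "{y \<in> space ?S. y i = 1} \<in> sets ?S" by measurable
  qed simp
  have A1: "A1 \<in> sets ?S" unfolding A1_def by measurable
  have "prob (\<Inter>i\<in>{0,1}. X i -` (if i = 0 then A0 else A1) \<inter> space M)
     = (\<Prod>i\<in>{0,1::nat}. prob (X i -` (if i = 0 then A0 else A1) \<inter> space M))"
    using sequences_indep A0 A1 unfolding X_def by (intro indep_varsD) auto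
  moreover have "X 0 -` A0 \<inter> space M = {\<omega> \<in> space M. \<forall>i\<in>{1..Suc n}. Y i \<omega> = 1}"
    by (auto simp: A0_def X_def space_PiM)
  moreover have "X 1 -` A1 \<inter> space M = {\<omega> \<in> space M. partial_sum R n \<omega> \<le> t \<and> t < partial_sum R (Suc n) \<omega>}"
  proof -
    have "(\<Sum>i=1..k. X 1 \<omega> i) = partial_sum R k \<omega>" for \<omega> k
      unfolding partial_sum_def by (intro sum.cong) (auto simp: X_def)
    moreover have "X 1 \<omega> \<in> space ?S" for \<omega> by (simp add: X_def space_PiM)
    ultimately show ?thesis by (auto simp: A1_def simp del: sum.cl_ivl_Suc partial_sum_Suc)
  qed
  moreover have "{\<omega> \<in> space M. (\<forall>i\<in>{1..Suc n}. Y i \<omega> = 1) \<and> partial_sum R n \<omega> \<le> t \<and> t < partial_sum R (Suc n) \<omega>}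
    = {\<omega> \<in> space M. \<forall>i\<in>{1..Suc n}. Y i \<omega> = 1} \<inter> {\<omega> \<in> space M. partial_sum R n \<omega> \<le> t \<and> t < partial_sum R (Suc n) \<omega>}"
    by auto
  ultimately show ?thesis by simp
qed

end

section \<open>The symmetry between heads and tails\<close>

lemma (in prob_space) indep_sets_reindex:
  assumes inj: "inj_on \<sigma> I" and ind: "indep_sets F (\<sigma> ` I)"
  shows "indep_sets (\<lambda>i. F (\<sigma> i)) I"
  unfolding indep_sets_def
proof (intro conjI ballI allI impI)
  show "F (\<sigma> i) \<subseteq> events" if "i \<in> I" for i
    using ind that by (auto simp: indep_sets_def)
  fix J A assume J: "J \<subseteq> I" "J \<noteq> {}" "finite J" and A: "A \<in> (\<Pi> i\<in>J. F (\<sigma> i))"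
  have injJ: "inj_on \<sigma> J" using inj J(1) by (rule inj_on_subset)
  define B where "B k = A (inv_into J \<sigma> k)" for k
  have B: "B (\<sigma> j) = A j" if "j \<in> J" for j using injJ that by (simp add: B_def)
  have "prob (\<Inter>k\<in>\<sigma> ` J. B k) = (\<Prod>k\<in>\<sigma> ` J. prob (B k))"
    using J A B by (intro indep_setsD[OF ind]) auto
  then show "prob (\<Inter>j\<in>J. A j) = (\<Prod>j\<in>J. prob (A j))"
    using injJ B by (simp add: prod.reindex)
qed

lemma (in prob_space) indep_vars_reindex:
  assumes "inj_on \<sigma> I" "indep_vars M' X (\<sigma> ` I)"
  shows "indep_vars (\<lambda>i. M' (\<sigma> i)) (\<lambda>i. X (\<sigma> i)) I"
  using assms indep_sets_reindex[of \<sigma> I "\<lambda>i. {X i -` A \<inter> space M | A. A \<in> sets (M' i)}"]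
  unfolding indep_vars_def2 by auto

context mittag_leffler_telegraph
begin

text \<open>All defining data are symmetric: the conditional probability of a tail after \<open>m\<close> trials with
  \<open>k\<close> tails is \<open>(r + c k) / (b + r + c m)\<close>.\<close>
lemma heads_tails_swap: "mittag_leffler_telegraph M \<alpha> v2 v1 mu lam r b c (\<lambda>n \<omega>. 1 - Y n \<omega>) L R"
proof
  show "0 < \<alpha>" "\<alpha> \<le> 1" "0 < v2" "0 < v1" "0 < mu" "0 < lam" "0 < r" "0 < b" "0 < c"
    using alpha pos by auto
  show "(\<lambda>\<omega>. 1 - Y n \<omega>) \<in> M \<rightarrow>\<^sub>M count_space UNIV" if "n \<ge> 1" for n
    using measurable_compose[OF Y_measurable[OF that], of "\<lambda>k. 1 - k" "count_space UNIV"] by simp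
  show "1 - Y n \<omega> \<in> {0, 1}" if "n \<ge> 1" "\<omega> \<in> space M" for n \<omega>
    using Y_values[OF that] by auto
  note [measurable] = Y_measurable
  have Y01: "Y n \<omega> = 0 \<or> Y n \<omega> = 1" if "n \<ge> 1" "\<omega> \<in> space M" for n \<omega>
    using Y_values[OF that] by auto
  have "{\<omega> \<in> space M. 1 - Y 1 \<omega> = 1} = space M - {\<omega> \<in> space M. Y 1 \<omega> = 1}"
  proof (rule set_eqI)
    fix \<omega>
    show "\<omega> \<in> {\<omega> \<in> space M. 1 - Y 1 \<omega> = 1} \<longleftrightarrow> \<omega> \<in> space M - {\<omega> \<in> space M. Y 1 \<omega> = 1}"
      using Y01[of 1 \<omega>] by auto
  qed
  then have "\<P>(\<omega> in M. 1 - Y 1 \<omega> = 1) = 1 - b / (b + r)"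
    using Y_first by (simp add: prob_compl)
  then show "\<P>(\<omega> in M. 1 - Y 1 \<omega> = 1) = r / (r + b)"
    using pos by (simp add: field_simps)
  show "\<P>(\<omega> in M. 1 - Y (m + 1) \<omega> = 1 \<bar> \<forall>i\<in>{1..m}. 1 - Y i \<omega> = y i)
        = (r + c * real (\<Sum>i=1..m. y i)) / (r + b + c * real m)"
    if m: "m \<ge> 1" and Q0: "\<P>(\<omega> in M. \<forall>i\<in>{1..m}. 1 - Y i \<omega> = y i) > 0" for m y
  proof -
    define Q where "Q = {\<omega> \<in> space M. \<forall>i\<in>{1..m}. Y i \<omega> = 1 - y i}"
    have "{\<omega> \<in> space M. \<forall>i\<in>{1..m}. 1 - Y i \<omega> = y i} \<noteq> {}"
      using Q0 by (metis less_irrefl measure_empty)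
    then obtain \<omega>0 where "\<omega>0 \<in> space M" "\<forall>i\<in>{1..m}. 1 - Y i \<omega>0 = y i" by blast
    then have y: "y i \<le> 1" if "i \<in> {1..m}" for i using that by (metis diff_le_self)
    have iff: "(\<forall>i\<in>{1..m}. 1 - Y i \<omega> = y i) \<longleftrightarrow> (\<forall>i\<in>{1..m}. Y i \<omega> = 1 - y i)" if "\<omega> \<in> space M" for \<omega>
    proof (intro ball_cong refl)
      fix i assume i: "i \<in> {1..m}"
      then show "(1 - Y i \<omega> = y i) \<longleftrightarrow> (Y i \<omega> = 1 - y i)"
        using y[OF i] Y01[of i \<omega>] that by auto
    qed
    have Q: "{\<omega> \<in> space M. \<forall>i\<in>{1..m}. 1 - Y i \<omega> = y i} = Q"
      using iff by (auto simp: Q_def)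
    have QM: "Q \<in> events" unfolding Q_def
    proof (rule sets.sets_Collect_finite_All)
      fix i assume "i \<in> {1..m}"
      then have [measurable]: "Y i \<in> M \<rightarrow>\<^sub>M count_space UNIV" by (intro Y_measurable) auto
      show "{\<omega> \<in> space M. Y i \<omega> = 1 - y i} \<in> events" by measurable
    qed simp
    define H where "H = {\<omega> \<in> space M. Y (m + 1) \<omega> = 1 \<and> (\<forall>i\<in>{1..m}. Y i \<omega> = 1 - y i)}"
    have HM: "H \<in> events"
    proof -
      have "H = {\<omega> \<in> space M. Y (m + 1) \<omega> = 1} \<inter> Q" by (auto simp: H_def Q_def)
      moreover have "{\<omega> \<in> space M. Y (m + 1) \<omega> = 1} \<in> events" by measurable
      ultimately show ?thesis using QM by simp
    qed
    have pQ: "prob Q > 0" using Q0 Q by simp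
    have "prob H / prob Q = (b + c * real (\<Sum>i=1..m. 1 - y i)) / (b + r + c * real m)"
      using Y_next[of m "\<lambda>i. 1 - y i"] m pQ by (simp add: cond_prob_def H_def Q_def)
    moreover have "real (\<Sum>i=1..m. 1 - y i) = real m - real (\<Sum>i=1..m. y i)"
    proof -
      have "real (\<Sum>i=1..m. 1 - y i) = (\<Sum>i=1..m. 1 - real (y i))"
        unfolding of_nat_sum using y by (intro sum.cong) (auto simp: of_nat_diff)
      then show ?thesis by (simp add: sum_subtractf)
    qed
    ultimately have "prob H / prob Q = (b + c * (real m - real (\<Sum>i=1..m. y i))) / (b + r + c * real m)"
      by simp
    moreover have "1 - (b + c * (real m - s)) / (b + r + c * real m) = (r + c * s) / (r + b + c * real m)" for s
    proof -
      have "b + r + c * real m > 0" using pos by (simp add: add_pos_nonneg)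
      then show ?thesis by (simp add: field_simps)
    qed
    moreover have QH: "{\<omega> \<in> space M. 1 - Y (m + 1) \<omega> = 1 \<and> (\<forall>i\<in>{1..m}. 1 - Y i \<omega> = y i)} = Q - H"
    proof (rule set_eqI)
      fix \<omega>
      show "\<omega> \<in> {\<omega> \<in> space M. 1 - Y (m + 1) \<omega> = 1 \<and> (\<forall>i\<in>{1..m}. 1 - Y i \<omega> = y i)} \<longleftrightarrow> \<omega> \<in> Q - H"
      proof (cases "\<omega> \<in> space M")
        case True
        have "1 - Y (m + 1) \<omega> = 1 \<longleftrightarrow> Y (m + 1) \<omega> \<noteq> 1" using Y01[of "m + 1" \<omega>] True by auto
        then show ?thesis using iff[OF True] True unfolding Q_def H_def by blast
      qed (simp add: Q_def)
    qed
    moreover have "prob (Q - H) = prob Q - prob H"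
      using QM HM by (intro finite_measure_Diff) (auto simp: Q_def H_def)
    moreover have "\<P>(\<omega> in M. 1 - Y (m + 1) \<omega> = 1 \<bar> \<forall>i\<in>{1..m}. 1 - Y i \<omega> = y i) = prob (Q - H) / prob Q"
      unfolding cond_prob_def QH Q ..
    moreover have "(prob Q - prob H) / prob Q = 1 - prob H / prob Q"
      using pQ by (simp add: diff_divide_distrib)
    ultimately show ?thesis by (simp only:)
  qed
  show "has_density M (L 1) (\<lambda>t. if t > 0 then
        mu powr (r / c + 1) * t powr (\<alpha> * (r / c + 1) - 1)
          * mittag_leffler3 \<alpha> (\<alpha> * (r / c + 1)) (r / c + 1) (- mu * t powr \<alpha>) else 0)" by (rule L_first)
  show "has_density M (R 1) (\<lambda>t. if t > 0 then
        lam powr (b / c + 1) * t powr (\<alpha> * (b / c + 1) - 1)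
          * mittag_leffler3 \<alpha> (\<alpha> * (b / c + 1)) (b / c + 1) (- lam * t powr \<alpha>) else 0)" by (rule R_first)
  show "\<And>n. n \<ge> 2 \<Longrightarrow> has_density M (L n) (\<lambda>t. if t > 0 then
        mu * t powr (\<alpha> - 1) * mittag_leffler \<alpha> \<alpha> (- mu * t powr \<alpha>) else 0)" by (rule L_next)
  show "\<And>n. n \<ge> 2 \<Longrightarrow> has_density M (R n) (\<lambda>t. if t > 0 then
        lam * t powr (\<alpha> - 1) * mittag_leffler \<alpha> \<alpha> (- lam * t powr \<alpha>) else 0)" by (rule R_next)
  show "indep_vars (\<lambda>_. borel) L {1..}" by (rule L_indep)
  show "indep_vars (\<lambda>_. borel) R {1..}" by (rule R_indep)
  show "indep_vars (\<lambda>_. PiM {1..} (\<lambda>_. borel))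
      (\<lambda>i \<omega>. \<lambda>n\<in>{1..}. [real (1 - Y n \<omega>), L n \<omega>, R n \<omega>] ! i) {..<3}"
  proof -
    let ?S = "PiM {1::nat..} (\<lambda>_. borel :: real measure)"
    define X where "X i \<omega> = (\<lambda>n\<in>{1::nat..}. [real (Y n \<omega>), R n \<omega>, L n \<omega>] ! i)" for i \<omega>
    define \<sigma> :: "nat \<Rightarrow> nat" where "\<sigma> i = (if i = 1 then 2 else if i = 2 then 1 else i)" for i
    \<comment> \<open>The first sequence is transformed by a function defined on all reals so that the
      identity with the trials \<open>1 - Y\<close> holds at every point, not only where \<open>Y\<close> is at most \<open>1\<close>.\<close>
    define h where "h i x = (\<lambda>n\<in>{1::nat..}. if i = (0::nat) then real (1 - nat \<lfloor>x n\<rfloor>) else x n)" for i and x :: "nat \<Rightarrow> real"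
    have im: "\<sigma> ` {..<3} = {..<3}"
    proof -
      have "{..<3} = {0, 1, 2::nat}" by auto
      then show ?thesis by (auto simp: \<sigma>_def)
    qed
    have "indep_vars (\<lambda>_. ?S) (\<lambda>i. X (\<sigma> i)) {..<3}"
    proof (rule indep_vars_reindex)
      show "inj_on \<sigma> {..<3}" by (auto simp: \<sigma>_def inj_on_def)
      show "indep_vars (\<lambda>_. ?S) X (\<sigma> ` {..<3})"
        using sequences_indep unfolding im X_def[abs_def] .
    qed
    then have "indep_vars (\<lambda>_. ?S) (\<lambda>i \<omega>. h i (X (\<sigma> i) \<omega>)) {..<3}"
    proof (rule indep_vars_compose2)
      fix i
      have "(\<lambda>x. if i = (0::nat) then real (1 - nat \<lfloor>x n\<rfloor>) else x n) \<in> borel_measurable ?S" if "n \<in> {1..}" for n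
      proof -
        have comp: "(\<lambda>x. x n) \<in> borel_measurable ?S" using that by (rule measurable_component_singleton)
        have "(\<lambda>z::real. real (1 - nat \<lfloor>z\<rfloor>)) \<in> borel_measurable borel" by measurable
        from measurable_compose[OF comp this] comp show ?thesis by (cases "i = 0") simp_all
      qed
      then show "h i \<in> ?S \<rightarrow>\<^sub>M ?S" unfolding h_def[abs_def] by (intro measurable_restrict) auto
    qed
    moreover have eq: "h i (X (\<sigma> i) \<omega>) = (\<lambda>n\<in>{1..}. [real (1 - Y n \<omega>), L n \<omega>, R n \<omega>] ! i)" if "i \<in> {..<3}" for i \<omega>
    proof -
      have "i = 0 \<or> i = 1 \<or> i = 2" using that by auto
      then show ?thesis by (auto simp: h_def X_def \<sigma>_def fun_eq_iff)
    qed
    moreover have "indep_vars (\<lambda>_. ?S) (\<lambda>i \<omega>. h i (X (\<sigma> i) \<omega>)) {..<3} \<longleftrightarrow>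
        indep_vars (\<lambda>_. ?S) (\<lambda>i \<omega>. \<lambda>n\<in>{1..}. [real (1 - Y n \<omega>), L n \<omega>, R n \<omega>] ! i) {..<3}"
      by (intro indep_vars_cong refl) (rule ext, rule eq)
    ultimately show ?thesis by (simp only:)
  qed
qed

lemma L_measurable [measurable]: "n \<ge> 1 \<Longrightarrow> L n \<in> borel_measurable M"
  by (rule mittag_leffler_telegraph.R_measurable[OF heads_tails_swap])

lemma velocity_after_swap:
  assumes "\<omega> \<in> space M"
  shows "velocity_after v2 v1 (\<lambda>n \<omega>. 1 - Y n \<omega>) n \<omega> = - velocity_after v1 v2 Y n \<omega>"
  using Y_values[of "Suc n" \<omega>] assms by (auto simp: velocity_after_def)

lemma switch_time_swap:
  assumes "\<omega> \<in> space M"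
  shows "switch_time v2 v1 (\<lambda>n \<omega>. 1 - Y n \<omega>) L R n \<omega> = T n \<omega>"
proof (induction n)
  case (Suc n)
  have sum: "(\<Sum>j=1..n. 1 - Y j \<omega>) = n - (\<Sum>j=1..n. Y j \<omega>)"
  proof (induction n)
    case (Suc n)
    then show ?case using Y_values[of "Suc n" \<omega>] assms head_count_le[OF assms, of n] by auto
  qed simp
  have le: "(\<Sum>j=1..n. Y j \<omega>) \<le> n" by (rule head_count_le[OF assms])
  have idx: "n + 1 - (n - (\<Sum>j=1..n. Y j \<omega>)) = (\<Sum>j=1..n. Y j \<omega>) + 1"
    "n - (\<Sum>j=1..n. Y j \<omega>) + 1 = n + 1 - (\<Sum>j=1..n. Y j \<omega>)" using le by auto
  have vel: "velocity_after v2 v1 (\<lambda>n \<omega>. 1 - Y n \<omega>) n \<omega> = v2 \<longleftrightarrow> velocity_after v1 v2 Y n \<omega> \<noteq> v1"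
    using Y_values[of "Suc n" \<omega>] assms pos by (auto simp: velocity_after_def)
  show ?case unfolding switch_time.simps Suc.IH sum vel idx by simp
qed simp

text \<open>The switching times do not change, and every velocity changes its sign.\<close>
lemma telegraph_position_swap:
  assumes "\<omega> \<in> space M"
  shows "telegraph_position v2 v1 (\<lambda>n \<omega>. 1 - Y n \<omega>) L R t \<omega> = - telegraph_position v1 v2 Y R L t \<omega>"
  unfolding telegraph_position_def telegraph_velocity_def switch_count_def
    switch_time_swap[OF assms] velocity_after_swap[OF assms]
  by (simp add: set_lebesgue_integral_def)

section \<open>Sample paths\<close>

lemma switch_time_eq:
  assumes "\<omega> \<in> space M"
  shows "T n \<omega> = partial_sum R (\<Sum>j=1..n. Y j \<omega>) \<omega> + partial_sum L (n - (\<Sum>j=1..n. Y j \<omega>)) \<omega>"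
proof (induction n)
  case (Suc n)
  have le: "(\<Sum>j=1..n. Y j \<omega>) \<le> n" by (rule head_count_le[OF assms])
  have "Y (Suc n) \<omega> = 0 \<or> Y (Suc n) \<omega> = 1" using Y_values[of "Suc n" \<omega>] assms by auto
  then show ?case
  proof
    assume "Y (Suc n) \<omega> = 1"
    then show ?thesis using Suc.IH by simp
  next
    assume "Y (Suc n) \<omega> = 0"
    then show ?thesis using Suc.IH le by (simp add: Suc_diff_le)
  qed
qed simp

text \<open>The last condition excludes a switch at time \<open>t\<close> itself: if the first tail took effect only at
  that instant, the position would still be \<open>v1 t\<close> although not all governing trials are heads.\<close>
definition regular_path :: "real \<Rightarrow> 'a \<Rightarrow> bool" where
  "regular_path t \<omega> \<longleftrightarrow> (\<forall>i\<ge>1. R i \<omega> > 0) \<and> (\<forall>i\<ge>1. L i \<omega> > 0) \<and>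
    (\<forall>x. \<exists>n. partial_sum R n \<omega> > x) \<and> (\<forall>x. \<exists>n. partial_sum L n \<omega> > x) \<and>
    (\<forall>n. partial_sum R n \<omega> \<noteq> t)"

lemma AE_regular_path:
  assumes "t > 0"
  shows "AE \<omega> in M. regular_path t \<omega>"
  using R_AE_pos mittag_leffler_telegraph.R_AE_pos[OF heads_tails_swap] partial_sum_R_AE_unbounded
    mittag_leffler_telegraph.partial_sum_R_AE_unbounded[OF heads_tails_swap] partial_sum_R_AE_neq[OF assms]
  by eventually_elim (simp add: regular_path_def)

text \<open>Among \<open>n1 + n2\<close> trials there are at least \<open>n1\<close> heads or at least \<open>n2\<close> tails, so if
  the \<open>n1\<close>-th partial sum of \<open>R\<close> and the \<open>n2\<close>-th one of \<open>L\<close> exceed a level, so does the switching time.\<close>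
lemma switch_time_unbounded:
  assumes "\<omega> \<in> space M" "regular_path t \<omega>"
  shows "\<exists>n. T n \<omega> > s"
proof -
  have R: "\<forall>i\<ge>1. R i \<omega> > 0" and L: "\<forall>i\<ge>1. L i \<omega> > 0" using assms(2) by (auto simp: regular_path_def)
  obtain n1 n2 where n: "partial_sum R n1 \<omega> > s" "partial_sum L n2 \<omega> > s"
    using assms(2) unfolding regular_path_def by blast
  define k where "k = (\<Sum>j=1..n1 + n2. Y j \<omega>)"
  have nonneg: "partial_sum R k \<omega> \<ge> 0" "partial_sum L (n1 + n2 - k) \<omega> \<ge> 0"
    using partial_sum_mono[of R \<omega> 0 k, OF R] partial_sum_mono[of L \<omega> 0, OF L] by auto
  have "n1 \<le> k \<or> n2 \<le> n1 + n2 - k" by linarith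
  then have "T (n1 + n2) \<omega> > s"
    unfolding switch_time_eq[OF assms(1)] k_def[symmetric]
    using partial_sum_mono[of R \<omega> n1 k, OF R] partial_sum_mono[of L \<omega> n2 "n1 + n2 - k", OF L] n nonneg by linarith
  then show ?thesis by blast
qed

lemma switch_time_strict_mono:
  assumes "\<omega> \<in> space M" "regular_path t \<omega>"
  shows "strict_mono (\<lambda>n. T n \<omega>)"
  unfolding strict_mono_Suc_iff
proof
  fix n
  show "T n \<omega> < T (Suc n) \<omega>"
    using head_count_le[OF assms(1), of n] assms(2) by (simp add: regular_path_def)
qed

section \<open>Measurability of the position\<close>

lemma head_count_measurable [measurable]:
  "(\<lambda>\<omega>. \<Sum>j=1..n. Y j \<omega>) \<in> M \<rightarrow>\<^sub>M count_space UNIV"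
proof (induction n)
  case (Suc n)
  have [measurable]: "Y (Suc n) \<in> M \<rightarrow>\<^sub>M count_space UNIV" by (intro Y_measurable) auto
  note [measurable] = Suc.IH
  have "(\<lambda>\<omega>. (\<Sum>j=1..n. Y j \<omega>) + Y (Suc n) \<omega>) \<in> M \<rightarrow>\<^sub>M count_space UNIV" by measurable
  then show ?case by simp
qed simp

lemma velocity_after_measurable [measurable]:
  "(\<lambda>\<omega>. velocity_after v1 v2 Y n \<omega>) \<in> borel_measurable M"
proof -
  have [measurable]: "Y (Suc n) \<in> M \<rightarrow>\<^sub>M count_space UNIV" by (intro Y_measurable) auto
  show ?thesis unfolding velocity_after_def by measurable
qed

lemma switch_time_measurable [measurable]: "(\<lambda>\<omega>. T n \<omega>) \<in> borel_measurable M"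
proof (induction n)
  case (Suc n)
  note [measurable] = Suc.IH
  let ?K = "\<lambda>\<omega>. \<Sum>j=1..n. Y j \<omega>"
  have R: "(\<lambda>\<omega>. R (?K \<omega> + 1) \<omega>) \<in> borel_measurable M"
    by (rule measurable_compose_countable[where f = "\<lambda>i. R (i + 1)"]) (auto intro: R_measurable)
  have "(\<lambda>\<omega>. L (max 1 (n + 1 - ?K \<omega>)) \<omega>) \<in> borel_measurable M"
    by (rule measurable_compose_countable[where f = "\<lambda>i. L (max 1 (n + 1 - i))"]) (auto intro: L_measurable)
  then have L: "(\<lambda>\<omega>. L (n + 1 - ?K \<omega>) \<omega>) \<in> borel_measurable M"
  proof (rule measurable_cong[THEN iffD1, rotated])
    fix \<omega> assume "\<omega> \<in> space M"
    then have "n + 1 - ?K \<omega> \<ge> 1" using head_count_le[of \<omega> n] by linarith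
    then show "L (max 1 (n + 1 - ?K \<omega>)) \<omega> = L (n + 1 - ?K \<omega>) \<omega>" by (simp only: max.absorb2)
  qed
  note [measurable] = R L
  show ?case unfolding switch_time.simps by measurable
qed simp

text \<open>The case distinction treats the empty and the infinite set separately, where the maximum is a
  constant; elsewhere the value of the maximum is a countable combination of inequalities.\<close>
lemma switch_count_measurable [measurable]:
  "(\<lambda>x. N (snd x) (fst x)) \<in> M \<Otimes>\<^sub>M borel \<rightarrow>\<^sub>M count_space UNIV"
  unfolding measurable_count_space_eq2_countable
proof (intro conjI ballI)
  fix k :: nat
  define P where "P x \<longleftrightarrow> (\<exists>n. T n (fst x) \<le> snd x)" for x :: "'a \<times> real"
  define Q where "Q x \<longleftrightarrow> (\<exists>m. \<forall>n. T n (fst x) \<le> snd x \<longrightarrow> n \<le> m)" for x :: "'a \<times> real"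
  have iff: "N (snd x) (fst x) = k \<longleftrightarrow>
    (if P x then if Q x then T k (fst x) \<le> snd x \<and> (\<forall>n. T n (fst x) \<le> snd x \<longrightarrow> n \<le> k)
      else k = Max (UNIV :: nat set) else k = Max {})" for x
  proof -
    let ?A = "{n. T n (fst x) \<le> snd x}"
    have fin: "finite ?A \<longleftrightarrow> Q x" by (auto simp: Q_def finite_nat_set_iff_bounded_le)
    have ne: "?A \<noteq> {} \<longleftrightarrow> P x" by (auto simp: P_def)
    show ?thesis
    proof (cases "P x \<and> Q x")
      case True
      then show ?thesis using fin ne by (auto simp: switch_count_def Max_eq_iff)
    next
      case False
      then show ?thesis using fin ne
        by (cases "P x") (auto simp: switch_count_def Max.infinite)
    qed
  qed
  have "{x \<in> space (M \<Otimes>\<^sub>M borel). N (snd x) (fst x) = k} \<in> sets (M \<Otimes>\<^sub>M borel)"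
    unfolding iff P_def Q_def by measurable
  then show "(\<lambda>x. N (snd x) (fst x)) -` {k} \<inter> space (M \<Otimes>\<^sub>M borel) \<in> sets (M \<Otimes>\<^sub>M borel)"
    by (simp add: vimage_def Int_def conj_commute)
qed simp

lemma telegraph_velocity_measurable_pair:
  "(\<lambda>x. V (snd x) (fst x)) \<in> borel_measurable (M \<Otimes>\<^sub>M borel)"
  unfolding telegraph_velocity_def
  by (rule measurable_compose_countable[where f = "\<lambda>n x. velocity_after v1 v2 Y n (fst x)"]) measurable

lemma telegraph_velocity_measurable:
  assumes "\<omega> \<in> space M"
  shows "(\<lambda>s. V s \<omega>) \<in> borel_measurable borel"
proof -
  have "(\<lambda>s. (\<omega>, s)) \<in> borel \<rightarrow>\<^sub>M M \<Otimes>\<^sub>M borel" using assms by measurable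
  from measurable_compose[OF this telegraph_velocity_measurable_pair] show ?thesis by simp
qed

lemma telegraph_position_measurable [measurable]:
  "(\<lambda>\<omega>. telegraph_position v1 v2 Y R L t \<omega>) \<in> borel_measurable M"
proof -
  note [measurable] = telegraph_velocity_measurable_pair
  have "(\<lambda>x. indicator {0..t} (snd x) *\<^sub>R V (snd x) (fst x)) \<in> borel_measurable (M \<Otimes>\<^sub>M lborel)"
    by measurable
  then have "(\<lambda>\<omega>. \<integral>s. indicator {0..t} s *\<^sub>R V s \<omega> \<partial>lborel) \<in> borel_measurable M"
    by (intro lborel.borel_measurable_lebesgue_integral) (simp add: case_prod_beta')
  then show ?thesis by (simp add: telegraph_position_def set_lebesgue_integral_def)
qed

section \<open>The event of maximal displacement\<close>

lemma telegraph_velocity_cases: "V s \<omega> = v1 \<or> V s \<omega> = - v2"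
  by (auto simp: telegraph_velocity_def velocity_after_def)

lemma switch_time_heads:
  assumes "\<forall>i\<in>{1..n}. Y i \<omega> = 1" "m \<le> n"
  shows "T m \<omega> = partial_sum R m \<omega>"
  using assms(2)
proof (induction m)
  case (Suc m)
  have "(\<Sum>j=1..m. Y j \<omega>) = (\<Sum>j=1..m. 1)" using assms Suc.prems by (intro sum.cong) auto
  then have "(\<Sum>j=1..m. Y j \<omega>) = m" by simp
  then show ?case using Suc assms(1) by simp
qed simp

text \<open>If some tail takes effect before \<open>t\<close>, the velocity is \<open>- v2\<close> on an interval of positive length
  inside \<open>[0, t]\<close>, and the integral falls short of \<open>v1 t\<close>. Otherwise all trials up to the one
  governing time \<open>t\<close> are heads.\<close>
lemma telegraph_position_eq_iff:
  assumes \<omega>: "\<omega> \<in> space M" and reg: "regular_path t \<omega>" and t: "t > 0"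
  shows "telegraph_position v1 v2 Y R L t \<omega> = v1 * t \<longleftrightarrow>
    (\<exists>n. (\<forall>i\<in>{1..Suc n}. Y i \<omega> = 1) \<and> partial_sum R n \<omega> \<le> t \<and> t < partial_sum R (Suc n) \<omega>)"
proof
  note mono = switch_time_strict_mono[OF \<omega> reg]
  have T0: "T 0 \<omega> \<le> s" if "s \<ge> 0" for s using that by simp
  have clock: "T (N s \<omega>) \<omega> \<le> s" "s < T (Suc (N s \<omega>)) \<omega>"
    "\<And>n. s < T (Suc n) \<omega> \<Longrightarrow> N s \<omega> \<le> n" "\<And>n. T n \<omega> \<le> s \<Longrightarrow> n \<le> N s \<omega>" if "s \<ge> 0" for s
    using Max_clock[OF mono T0[OF that] switch_time_unbounded[OF \<omega> reg]]
    by (simp_all only: switch_count_def)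
  {
    assume "\<exists>n. (\<forall>i\<in>{1..Suc n}. Y i \<omega> = 1) \<and> partial_sum R n \<omega> \<le> t \<and> t < partial_sum R (Suc n) \<omega>"
    then obtain n where n: "\<forall>i\<in>{1..Suc n}. Y i \<omega> = 1" "t < partial_sum R (Suc n) \<omega>" by blast
    have "V s \<omega> = v1" if s: "s \<in> {0..t}" for s
    proof -
      have "s < T (Suc n) \<omega>" using switch_time_heads[OF n(1) order_refl] n(2) s by simp
      then have "N s \<omega> \<le> n" using clock(3)[of s n] s by simp
      then show ?thesis using n(1) by (simp add: telegraph_velocity_def)
    qed
    then have "telegraph_position v1 v2 Y R L t \<omega> = (LINT s:{0..t}|lborel. v1)"
      unfolding telegraph_position_def by (intro set_lebesgue_integral_cong) auto
    also have "\<dots> = v1 * t" using t by (simp add: set_lebesgue_integral_def)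
    finally show "telegraph_position v1 v2 Y R L t \<omega> = v1 * t" .
  next
    assume pos_eq: "telegraph_position v1 v2 Y R L t \<omega> = v1 * t"
    define K where "K = N t \<omega>"
    have K: "T K \<omega> \<le> t" "t < T (Suc K) \<omega>" using clock(1,2)[of t] t by (auto simp: K_def)
    \<comment> \<open>A tail whose interval begins before \<open>t\<close> costs at least \<open>(v1 + v2)\<close> times the length of
      the part of that interval before \<open>t\<close>.\<close>
    have slow: False if j: "Y (Suc j) \<omega> \<noteq> 1" "T j \<omega> < t" for j
    proof -
      define u where "u = min (T (Suc j) \<omega>) t"
      have u: "T j \<omega> < u" "u \<le> t" using j strict_monoD[OF mono, of j "Suc j"] by (simp_all add: u_def del: switch_time.simps)
      have Tj: "T j \<omega> \<ge> 0" using strict_mono_leD[OF mono, of 0 j] by simp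
      have V: "V s \<omega> = - v2" if s: "s \<in> {T j \<omega>..<u}" for s
      proof -
        have "N s \<omega> = j"
          using clock(3)[of s j] clock(4)[of s j] s Tj by (auto simp: u_def intro: antisym)
        then show ?thesis using j(1) by (simp add: telegraph_velocity_def velocity_after_def)
      qed
      have int: "integrable lborel (\<lambda>s. indicator {0..t} s *\<^sub>R V s \<omega>)"
      proof (rule Bochner_Integration.integrable_bound)
        show "integrable lborel (\<lambda>s. (v1 + v2) * indicator {0..t} s :: real)"
            using t by (intro integrable_mult_right integrable_real_indicator) auto
        show "(\<lambda>s. indicator {0..t} s *\<^sub>R V s \<omega>) \<in> borel_measurable lborel"
          using telegraph_velocity_measurable[OF \<omega>] by measurable
        show "AE s in lborel. norm (indicator {0..t} s *\<^sub>R V s \<omega>) \<le> norm ((v1 + v2) * indicator {0..t} s)"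
        proof (rule AE_I2)
          fix s
          show "norm (indicator {0..t} s *\<^sub>R V s \<omega>) \<le> norm ((v1 + v2) * indicator {0..t} s)"
            using telegraph_velocity_cases[of s \<omega>] pos by (auto simp: indicator_def)
        qed
      qed
      have "telegraph_position v1 v2 Y R L t \<omega> = (\<integral>s. indicator {0..t} s *\<^sub>R V s \<omega> \<partial>lborel)"
        by (simp add: telegraph_position_def set_lebesgue_integral_def)
      also have "\<dots> \<le> (\<integral>s. v1 * indicator {0..t} s - (v1 + v2) * indicator {T j \<omega>..<u} s \<partial>lborel)"
      proof (rule integral_mono[OF int])
        show "integrable lborel (\<lambda>s. v1 * indicator {0..t} s - (v1 + v2) * indicator {T j \<omega>..<u} s :: real)"
          using u t by (intro Bochner_Integration.integrable_diff integrable_mult_right integrable_real_indicator) auto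
        fix s
        show "indicator {0..t} s *\<^sub>R V s \<omega> \<le> v1 * indicator {0..t} s - (v1 + v2) * indicator {T j \<omega>..<u} s"
          using V[of s] telegraph_velocity_cases[of s \<omega>] Tj u pos by (auto simp: indicator_def)
      qed
      also have "\<dots> = v1 * t - (v1 + v2) * (u - T j \<omega>)"
        using u t by (subst Bochner_Integration.integral_diff) (auto intro!: integrable_mult_right integrable_real_indicator)
      also have "\<dots> < v1 * t" using u pos by simp
      finally show False using pos_eq by simp
    qed
    have below: "Y (Suc j) \<omega> = 1" if "j < K" for j
      using slow[of j] strict_monoD[OF mono that] K(1) by fastforce
    then have headsK: "\<forall>i\<in>{1..K}. Y i \<omega> = 1"
      by (metis Suc_le_D Suc_le_lessD One_nat_def atLeastAtMost_iff)
    then have TK: "T K \<omega> = partial_sum R K \<omega>" by (intro switch_time_heads) auto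
    then have "T K \<omega> < t" using K(1) reg by (simp add: regular_path_def less_le)
    then have "Y (Suc K) \<omega> = 1" using slow[of K] by blast
    then have heads: "\<forall>i\<in>{1..Suc K}. Y i \<omega> = 1" using headsK by (auto simp: le_Suc_eq)
    have "T (Suc K) \<omega> = partial_sum R (Suc K) \<omega>" using heads by (intro switch_time_heads) auto
    then show "\<exists>n. (\<forall>i\<in>{1..Suc n}. Y i \<omega> = 1) \<and> partial_sum R n \<omega> \<le> t \<and> t < partial_sum R (Suc n) \<omega>"
      using heads K TK by (intro exI[of _ K]) simp
  }
qed

lemma prob_between_arrivals:
  "\<P>(\<omega> in M. partial_sum R n \<omega> \<le> t \<and> t < partial_sum R (Suc n) \<omega>)
    = \<P>(\<omega> in M. partial_sum R n \<omega> \<le> t) - \<P>(\<omega> in M. partial_sum R (Suc n) \<omega> \<le> t)"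
proof -
  define A where "A k = {\<omega> \<in> space M. partial_sum R k \<omega> \<le> t}" for k
  have A [measurable]: "A k \<in> events" for k unfolding A_def by measurable
  have "{\<omega> \<in> space M. partial_sum R n \<omega> \<le> t \<and> t < partial_sum R (Suc n) \<omega>} = A n - A n \<inter> A (Suc n)"
    unfolding A_def by (auto simp only: not_le)
  moreover have "prob (A n - A n \<inter> A (Suc n)) = prob (A n) - prob (A n \<inter> A (Suc n))"
    by (intro finite_measure_Diff) auto
  moreover have "prob (A n \<inter> A (Suc n)) = prob (A (Suc n))"
  proof (rule measure_eq_AE)
    show "AE \<omega> in M. \<omega> \<in> A n \<inter> A (Suc n) \<longleftrightarrow> \<omega> \<in> A (Suc n)"
      using R_AE_pos
    proof eventually_elim
      case (elim \<omega>)
      then have "R (Suc n) \<omega> > 0" by simp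
      then show ?case by (auto simp: A_def)
    qed
  qed auto
  ultimately show ?thesis by (simp only: A_def)
qed

text \<open>The events for different \<open>n\<close> are disjoint only where the waiting times are positive; they are
  therefore intersected with this event of probability one.\<close>
lemma prob_position_sums:
  assumes t: "t > 0"
  defines "\<Phi> \<equiv> arrival_cdf \<alpha> lam t (b / c)"
  shows "(\<lambda>n. run_prob (b / c) ((b + r) / c) (Suc n) * ((if n = 0 then 1 else \<Phi> n) - \<Phi> (Suc n)))
    sums \<P>(\<omega> in M. telegraph_position v1 v2 Y R L t \<omega> = v1 * t)"
proof -
  define E where "E n = {\<omega> \<in> space M. (\<forall>i\<in>{1..Suc n}. Y i \<omega> = 1) \<and> partial_sum R n \<omega> \<le> t \<and> t < partial_sum R (Suc n) \<omega>}" for n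
  define G where "G = {\<omega> \<in> space M. \<forall>i\<in>{1..}. R i \<omega> > 0}"
  have G: "G \<in> events" unfolding G_def
  proof (rule sets.sets_Collect_countable_All')
    fix i :: nat assume "i \<in> {1..}"
    then have [measurable]: "R i \<in> borel_measurable M" by (intro R_measurable) auto
    show "{\<omega> \<in> space M. R i \<omega> > 0} \<in> events" by measurable
  qed simp
  have E: "E n \<in> events" for n
  proof -
    have "{\<omega> \<in> space M. \<forall>i\<in>{1..Suc n}. Y i \<omega> = 1} \<in> events"
    proof (rule sets.sets_Collect_finite_All)
      fix i assume "i \<in> {1..Suc n}"
      then have [measurable]: "Y i \<in> M \<rightarrow>\<^sub>M count_space UNIV" by (intro Y_measurable) auto
      show "{\<omega> \<in> space M. Y i \<omega> = 1} \<in> events" by measurable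
    qed simp
    moreover have "{\<omega> \<in> space M. partial_sum R n \<omega> \<le> t \<and> t < partial_sum R (Suc n) \<omega>} \<in> events"
      by measurable
    moreover have "E n = {\<omega> \<in> space M. \<forall>i\<in>{1..Suc n}. Y i \<omega> = 1} \<inter>
        {\<omega> \<in> space M. partial_sum R n \<omega> \<le> t \<and> t < partial_sum R (Suc n) \<omega>}"
      by (auto simp: E_def)
    ultimately show ?thesis by auto
  qed
  have AE_G: "AE \<omega> in M. \<omega> \<in> G" using R_AE_pos AE_space by eventually_elim (auto simp: G_def)
  have disj: "disjoint_family (\<lambda>n. E n \<inter> G)"
    unfolding disjoint_family_on_def
  proof (intro ballI impI)
    have "E m \<inter> G \<inter> (E n \<inter> G) = {}" if "m < n" for m n
    proof -
      have False if \<omega>: "\<omega> \<in> E m" "\<omega> \<in> E n" "\<omega> \<in> G" for \<omega>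
      proof -
        have "partial_sum R (Suc m) \<omega> \<le> partial_sum R n \<omega>"
          using \<omega> \<open>m < n\<close> by (intro partial_sum_mono) (auto simp: G_def)
        moreover have "t < partial_sum R (Suc m) \<omega>" "partial_sum R n \<omega> \<le> t"
          using \<omega> unfolding E_def by blast+
        ultimately show False by linarith
      qed
      then show ?thesis by blast
    qed
    then show "E m \<inter> G \<inter> (E n \<inter> G) = {}" if "m \<noteq> n" for m n
      using that by (metis Int_commute linorder_neqE_nat)
  qed
  have "(\<lambda>n. prob (E n \<inter> G)) sums prob (\<Union>n. E n \<inter> G)"
    using E G disj by (intro finite_measure_UNION) auto
  moreover have "prob (\<Union>n. E n \<inter> G) = \<P>(\<omega> in M. telegraph_position v1 v2 Y R L t \<omega> = v1 * t)"
  proof (rule measure_eq_AE)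
    show "AE \<omega> in M. \<omega> \<in> (\<Union>n. E n \<inter> G) \<longleftrightarrow> \<omega> \<in> {\<omega> \<in> space M. telegraph_position v1 v2 Y R L t \<omega> = v1 * t}"
      using AE_regular_path[OF t] AE_G AE_space
    proof eventually_elim
      case (elim \<omega>)
      then show ?case using telegraph_position_eq_iff[OF elim(3,1) t] by (simp add: E_def del: partial_sum_Suc)
    qed
    show "(\<Union>n. E n \<inter> G) \<in> events" using E G by auto
    show "{\<omega> \<in> space M. telegraph_position v1 v2 Y R L t \<omega> = v1 * t} \<in> events" by measurable
  qed
  moreover have "prob (E n \<inter> G) = run_prob (b / c) ((b + r) / c) (Suc n) * ((if n = 0 then 1 else \<Phi> n) - \<Phi> (Suc n))" for n
  proof -
    have "prob (E n \<inter> G) = prob (E n)"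
      using E G AE_G by (intro measure_eq_AE) auto
    also have "\<dots> = run_prob (b / c) ((b + r) / c) (Suc n) *
        (\<P>(\<omega> in M. partial_sum R n \<omega> \<le> t) - \<P>(\<omega> in M. partial_sum R (Suc n) \<omega> \<le> t))"
      unfolding E_def run_indep_partial_sum heads_run_prob prob_between_arrivals ..
    also have "\<P>(\<omega> in M. partial_sum R (Suc n) \<omega> \<le> t) = \<Phi> (Suc n)"
      unfolding \<Phi>_def by (rule partial_sum_R_cdf) simp
    also have "\<P>(\<omega> in M. partial_sum R n \<omega> \<le> t) = (if n = 0 then 1 else \<Phi> n)"
    proof (cases "n = 0")
      case True
      then show ?thesis using t by (simp add: prob_space)
    next
      case False
      then show ?thesis unfolding \<Phi>_def by (subst partial_sum_R_cdf) auto
    qed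
    finally show ?thesis .
  qed
  ultimately show ?thesis by simp
qed

lemma prob_position_max:
  assumes t: "t > 0"
  shows "\<P>(\<omega> in M. telegraph_position v1 v2 Y R L t \<omega> = v1 * t) =
      b / (b + r) * (1 - (lam * t powr \<alpha>) powr (b / c + 1)
          * mittag_leffler3 \<alpha> (\<alpha> * (b / c + 1) + 1) (b / c + 1) (- lam * t powr \<alpha>))
      + b * (lam * t powr \<alpha>) powr (b / c + 1) / ((b + r) * Gamma (b / c + 1))
          * fox_wright [(b / c + 2, 1), ((b + r) / c + 1, 1)]
              [((b + r) / c + 2, 1), (\<alpha> * (b / c + 1) + 1, \<alpha>)] (- lam * t powr \<alpha>)"
proof -
  have par: "\<alpha> > 0" "lam > 0" "t > 0" "b / c > 0" "(b + r) / c \<ge> b / c"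
    using alpha pos t by (auto simp: divide_right_mono)
  have ratio: "(b / c) / ((b + r) / c) = b / (b + r)" using pos by simp
  have "b / (b + r) * z / g = b * z / ((b + r) * g)" for z g by simp
  then show ?thesis
    using sums_unique2[OF prob_position_sums[OF t] run_mixture_sums[OF par]]
    unfolding ratio by (simp only:)
qed

end

theorem proposition4p2:
  fixes M :: "'a measure"
    and \<alpha> v1 v2 lam mu b r c t :: real
    and Y :: "nat \<Rightarrow> 'a \<Rightarrow> nat"
    and R L :: "nat \<Rightarrow> 'a \<Rightarrow> real"
  assumes "mittag_leffler_telegraph M \<alpha> v1 v2 lam mu b r c Y R L"
    and "t > 0"
  shows "\<P>(\<omega> in M. telegraph_position v1 v2 Y R L t \<omega> = v1 * t) =
      b / (b + r) * (1 - (lam * t powr \<alpha>) powr (b / c + 1)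
          * mittag_leffler3 \<alpha> (\<alpha> * (b / c + 1) + 1) (b / c + 1) (- lam * t powr \<alpha>))
      + b * (lam * t powr \<alpha>) powr (b / c + 1) / ((b + r) * Gamma (b / c + 1))
          * fox_wright [(b / c + 2, 1), ((b + r) / c + 1, 1)]
              [((b + r) / c + 2, 1), (\<alpha> * (b / c + 1) + 1, \<alpha>)] (- lam * t powr \<alpha>)
    \<and> \<P>(\<omega> in M. telegraph_position v1 v2 Y R L t \<omega> = - v2 * t) =
      r / (b + r) * (1 - (mu * t powr \<alpha>) powr (r / c + 1)
          * mittag_leffler3 \<alpha> (\<alpha> * (r / c + 1) + 1) (r / c + 1) (- mu * t powr \<alpha>))
      + r * (mu * t powr \<alpha>) powr (r / c + 1) / ((b + r) * Gamma (r / c + 1))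
          * fox_wright [(r / c + 2, 1), ((b + r) / c + 1, 1)]
              [((b + r) / c + 2, 1), (\<alpha> * (r / c + 1) + 1, \<alpha>)] (- mu * t powr \<alpha>)"
proof -
  interpret mittag_leffler_telegraph M \<alpha> v1 v2 lam mu b r c Y R L by fact
  have "{\<omega> \<in> space M. telegraph_position v1 v2 Y R L t \<omega> = - v2 * t}
      = {\<omega> \<in> space M. telegraph_position v2 v1 (\<lambda>n \<omega>. 1 - Y n \<omega>) L R t \<omega> = v2 * t}"
    using telegraph_position_swap by auto
  then show ?thesis
    using prob_position_max[OF assms(2)] mittag_leffler_telegraph.prob_position_max[OF heads_tails_swap assms(2)]
    by (simp only: add.commute[of r b])
qed

end
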